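(* Let $X$ be a set, i.e. for all $x,y:X$ and $p,q:x=y$ we have $p=q$. Let $f:X\to X$ and $I:\prod_{x:X}(f(f(x))=f(x))$. Then $f$ has a splitting. That is, there exist a type $A$, maps $r:X\to A$ and $s:A\to X$, and homotopies $H:\prod_{a:A}(r(s(a))=a)$ and $K:\prod_{x:X}(s(r(x))=f(x))$.
   Context: Intensional Martin-Löf type theory; no extensionality axioms are assumed. *)

theory Defs
  imports Main
begin

text \<open>
  Intensional Martin-Loef type theory as a formal system: \<open>\<Pi>\<close>-types, \<open>\<Sigma>\<close>-types, coproducts, the
  empty type, the unit type, natural numbers, identity types, and a cumulative hierarchy of Russell
  universes. Neither equality reflection nor any axiom (function extensionality, univalence, K) is
  present.

  Terms are raw, in de Bruijn notation. An argument that binds \<open>k\<close> variables lives in a context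
  extended by \<open>k\<close> entries, the last bound variable having index 0:
  \<open>B\<close> in \<open>Pi A B\<close>, \<open>Sig A B\<close> and \<open>b\<close> in \<open>Lam A b\<close> bind one; in \<open>SigInd C g p\<close>, \<open>C\<close> binds one and \<open>g\<close>
  two; in \<open>CoprodInd C c d e\<close> each of \<open>C\<close>, \<open>c\<close>, \<open>d\<close> binds one; in \<open>EmptyInd C a\<close> and \<open>UnitInd C c a\<close>,
  \<open>C\<close> binds one; in \<open>NatInd C c d n\<close>, \<open>C\<close> binds one and \<open>d\<close> two (predecessor, then recursive value); in
  \<open>IdInd C c a b p\<close>, \<open>C\<close> binds three (two endpoints, then the path) and \<open>c\<close> one.
\<close>

datatype tm =
    Var nat
  | Univ nat
  | Pi tm tm
  | Lam tm tm
  | App tm tm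
  | Sig tm tm
  | Pr tm tm
  | SigInd tm tm tm
  | Coprod tm tm
  | InL tm
  | InR tm
  | CoprodInd tm tm tm tm
  | EmptyT
  | EmptyInd tm tm
  | UnitT
  | Star
  | UnitInd tm tm tm
  | NatT
  | Zero
  | Succ tm
  | NatInd tm tm tm tm
  | IdT tm tm tm
  | Refl tm
  | IdInd tm tm tm tm tm

definition up_ren :: "(nat \<Rightarrow> nat) \<Rightarrow> nat \<Rightarrow> nat" where
  "up_ren \<rho> = case_nat 0 (\<lambda>n. Suc (\<rho> n))"

primrec ren :: "(nat \<Rightarrow> nat) \<Rightarrow> tm \<Rightarrow> tm" where
  "ren \<rho> (Var n) = Var (\<rho> n)"
| "ren \<rho> (Univ i) = Univ i"
| "ren \<rho> (Pi A B) = Pi (ren \<rho> A) (ren (up_ren \<rho>) B)"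
| "ren \<rho> (Lam A b) = Lam (ren \<rho> A) (ren (up_ren \<rho>) b)"
| "ren \<rho> (App f a) = App (ren \<rho> f) (ren \<rho> a)"
| "ren \<rho> (Sig A B) = Sig (ren \<rho> A) (ren (up_ren \<rho>) B)"
| "ren \<rho> (Pr a b) = Pr (ren \<rho> a) (ren \<rho> b)"
| "ren \<rho> (SigInd C g p) = SigInd (ren (up_ren \<rho>) C) (ren (up_ren (up_ren \<rho>)) g) (ren \<rho> p)"
| "ren \<rho> (Coprod A B) = Coprod (ren \<rho> A) (ren \<rho> B)"
| "ren \<rho> (InL a) = InL (ren \<rho> a)"
| "ren \<rho> (InR b) = InR (ren \<rho> b)"
| "ren \<rho> (CoprodInd C c d e) =
     CoprodInd (ren (up_ren \<rho>) C) (ren (up_ren \<rho>) c) (ren (up_ren \<rho>) d) (ren \<rho> e)"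
| "ren \<rho> EmptyT = EmptyT"
| "ren \<rho> (EmptyInd C a) = EmptyInd (ren (up_ren \<rho>) C) (ren \<rho> a)"
| "ren \<rho> UnitT = UnitT"
| "ren \<rho> Star = Star"
| "ren \<rho> (UnitInd C c a) = UnitInd (ren (up_ren \<rho>) C) (ren \<rho> c) (ren \<rho> a)"
| "ren \<rho> NatT = NatT"
| "ren \<rho> Zero = Zero"
| "ren \<rho> (Succ n) = Succ (ren \<rho> n)"
| "ren \<rho> (NatInd C c d n) =
     NatInd (ren (up_ren \<rho>) C) (ren \<rho> c) (ren (up_ren (up_ren \<rho>)) d) (ren \<rho> n)"
| "ren \<rho> (IdT A a b) = IdT (ren \<rho> A) (ren \<rho> a) (ren \<rho> b)"
| "ren \<rho> (Refl a) = Refl (ren \<rho> a)"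
| "ren \<rho> (IdInd C c a b p) =
     IdInd (ren (up_ren (up_ren (up_ren \<rho>))) C) (ren (up_ren \<rho>) c) (ren \<rho> a) (ren \<rho> b) (ren \<rho> p)"

abbreviation wk :: "nat \<Rightarrow> tm \<Rightarrow> tm" where
  "wk k \<equiv> ren (\<lambda>n. n + k)"

definition scons :: "tm \<Rightarrow> (nat \<Rightarrow> tm) \<Rightarrow> nat \<Rightarrow> tm" (infixr "\<cdot>" 65) where
  "a \<cdot> \<sigma> = case_nat a \<sigma>"

definition shift :: "nat \<Rightarrow> nat \<Rightarrow> tm" where
  "shift k n = Var (n + k)"

definition up :: "(nat \<Rightarrow> tm) \<Rightarrow> nat \<Rightarrow> tm" where
  "up \<sigma> = Var 0 \<cdot> (\<lambda>n. wk 1 (\<sigma> n))"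

primrec sub :: "(nat \<Rightarrow> tm) \<Rightarrow> tm \<Rightarrow> tm" where
  "sub \<sigma> (Var n) = \<sigma> n"
| "sub \<sigma> (Univ i) = Univ i"
| "sub \<sigma> (Pi A B) = Pi (sub \<sigma> A) (sub (up \<sigma>) B)"
| "sub \<sigma> (Lam A b) = Lam (sub \<sigma> A) (sub (up \<sigma>) b)"
| "sub \<sigma> (App f a) = App (sub \<sigma> f) (sub \<sigma> a)"
| "sub \<sigma> (Sig A B) = Sig (sub \<sigma> A) (sub (up \<sigma>) B)"
| "sub \<sigma> (Pr a b) = Pr (sub \<sigma> a) (sub \<sigma> b)"
| "sub \<sigma> (SigInd C g p) = SigInd (sub (up \<sigma>) C) (sub (up (up \<sigma>)) g) (sub \<sigma> p)"
| "sub \<sigma> (Coprod A B) = Coprod (sub \<sigma> A) (sub \<sigma> B)"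
| "sub \<sigma> (InL a) = InL (sub \<sigma> a)"
| "sub \<sigma> (InR b) = InR (sub \<sigma> b)"
| "sub \<sigma> (CoprodInd C c d e) =
     CoprodInd (sub (up \<sigma>) C) (sub (up \<sigma>) c) (sub (up \<sigma>) d) (sub \<sigma> e)"
| "sub \<sigma> EmptyT = EmptyT"
| "sub \<sigma> (EmptyInd C a) = EmptyInd (sub (up \<sigma>) C) (sub \<sigma> a)"
| "sub \<sigma> UnitT = UnitT"
| "sub \<sigma> Star = Star"
| "sub \<sigma> (UnitInd C c a) = UnitInd (sub (up \<sigma>) C) (sub \<sigma> c) (sub \<sigma> a)"
| "sub \<sigma> NatT = NatT"
| "sub \<sigma> Zero = Zero"
| "sub \<sigma> (Succ n) = Succ (sub \<sigma> n)"
| "sub \<sigma> (NatInd C c d n) =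
     NatInd (sub (up \<sigma>) C) (sub \<sigma> c) (sub (up (up \<sigma>)) d) (sub \<sigma> n)"
| "sub \<sigma> (IdT A a b) = IdT (sub \<sigma> A) (sub \<sigma> a) (sub \<sigma> b)"
| "sub \<sigma> (Refl a) = Refl (sub \<sigma> a)"
| "sub \<sigma> (IdInd C c a b p) =
     IdInd (sub (up (up (up \<sigma>))) C) (sub (up \<sigma>) c) (sub \<sigma> a) (sub \<sigma> b) (sub \<sigma> p)"

abbreviation inst1 :: "tm \<Rightarrow> tm \<Rightarrow> tm" where
  "inst1 C a \<equiv> sub (a \<cdot> shift 0) C"

abbreviation inst2 :: "tm \<Rightarrow> tm \<Rightarrow> tm \<Rightarrow> tm" where
  "inst2 C a b \<equiv> sub (b \<cdot> a \<cdot> shift 0) C"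

abbreviation inst3 :: "tm \<Rightarrow> tm \<Rightarrow> tm \<Rightarrow> tm \<Rightarrow> tm" where
  "inst3 C a b c \<equiv> sub (c \<cdot> b \<cdot> a \<cdot> shift 0) C"

text \<open>
  A context lists its types, with the most recent one first; each entry lives in the context formed by
  the entries after it.  ``\<open>A\<close> is a type'' is the judgement \<open>\<Gamma> \<turnstile> A \<Colon> Univ i\<close> for some level \<open>i\<close>.
\<close>

inductive wf_ctx :: "tm list \<Rightarrow> bool"
  and has_type :: "tm list \<Rightarrow> tm \<Rightarrow> tm \<Rightarrow> bool" ("(_ \<turnstile>/ _ \<Colon>/ _)" [51, 51, 51] 50)
  and judg_eq :: "tm list \<Rightarrow> tm \<Rightarrow> tm \<Rightarrow> tm \<Rightarrow> bool" ("(_ \<turnstile>/ _ \<doteq>/ _ \<Colon>/ _)" [51, 51, 51, 51] 50)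
where
  ctx_empty: "wf_ctx []"
| ctx_ext: "\<lbrakk>wf_ctx \<Gamma>; \<Gamma> \<turnstile> A \<Colon> Univ i\<rbrakk> \<Longrightarrow> wf_ctx (A # \<Gamma>)"
| var: "\<lbrakk>wf_ctx \<Gamma>; n < length \<Gamma>\<rbrakk> \<Longrightarrow> \<Gamma> \<turnstile> Var n \<Colon> wk (Suc n) (\<Gamma> ! n)"

| eq_refl: "\<Gamma> \<turnstile> a \<Colon> A \<Longrightarrow> \<Gamma> \<turnstile> a \<doteq> a \<Colon> A"
| eq_sym: "\<Gamma> \<turnstile> a \<doteq> b \<Colon> A \<Longrightarrow> \<Gamma> \<turnstile> b \<doteq> a \<Colon> A"
| eq_trans: "\<lbrakk>\<Gamma> \<turnstile> a \<doteq> b \<Colon> A; \<Gamma> \<turnstile> b \<doteq> c \<Colon> A\<rbrakk> \<Longrightarrow> \<Gamma> \<turnstile> a \<doteq> c \<Colon> A"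
| conv: "\<lbrakk>\<Gamma> \<turnstile> a \<Colon> A; \<Gamma> \<turnstile> A \<doteq> B \<Colon> Univ i\<rbrakk> \<Longrightarrow> \<Gamma> \<turnstile> a \<Colon> B"
| eq_conv: "\<lbrakk>\<Gamma> \<turnstile> a \<doteq> b \<Colon> A; \<Gamma> \<turnstile> A \<doteq> B \<Colon> Univ i\<rbrakk> \<Longrightarrow> \<Gamma> \<turnstile> a \<doteq> b \<Colon> B"

| univ_intro: "wf_ctx \<Gamma> \<Longrightarrow> \<Gamma> \<turnstile> Univ i \<Colon> Univ (Suc i)"
| univ_cumul: "\<Gamma> \<turnstile> A \<Colon> Univ i \<Longrightarrow> \<Gamma> \<turnstile> A \<Colon> Univ (Suc i)"
| univ_cumul_eq: "\<Gamma> \<turnstile> A \<doteq> B \<Colon> Univ i \<Longrightarrow> \<Gamma> \<turnstile> A \<doteq> B \<Colon> Univ (Suc i)"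

| pi_form: "\<lbrakk>\<Gamma> \<turnstile> A \<Colon> Univ i; A # \<Gamma> \<turnstile> B \<Colon> Univ i\<rbrakk> \<Longrightarrow> \<Gamma> \<turnstile> Pi A B \<Colon> Univ i"
| pi_intro: "A # \<Gamma> \<turnstile> b \<Colon> B \<Longrightarrow> \<Gamma> \<turnstile> Lam A b \<Colon> Pi A B"
| pi_elim: "\<lbrakk>\<Gamma> \<turnstile> f \<Colon> Pi A B; \<Gamma> \<turnstile> a \<Colon> A\<rbrakk> \<Longrightarrow> \<Gamma> \<turnstile> App f a \<Colon> inst1 B a"
| pi_comp: "\<lbrakk>A # \<Gamma> \<turnstile> b \<Colon> B; \<Gamma> \<turnstile> a \<Colon> A\<rbrakk> \<Longrightarrow> \<Gamma> \<turnstile> App (Lam A b) a \<doteq> inst1 b a \<Colon> inst1 B a"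
| pi_uniq: "\<Gamma> \<turnstile> f \<Colon> Pi A B \<Longrightarrow> \<Gamma> \<turnstile> f \<doteq> Lam A (App (wk 1 f) (Var 0)) \<Colon> Pi A B"
| pi_form_eq: "\<lbrakk>\<Gamma> \<turnstile> A \<doteq> A' \<Colon> Univ i; A # \<Gamma> \<turnstile> B \<doteq> B' \<Colon> Univ i\<rbrakk> \<Longrightarrow> \<Gamma> \<turnstile> Pi A B \<doteq> Pi A' B' \<Colon> Univ i"
| pi_intro_eq: "\<lbrakk>\<Gamma> \<turnstile> A \<doteq> A' \<Colon> Univ i; A # \<Gamma> \<turnstile> b \<doteq> b' \<Colon> B\<rbrakk> \<Longrightarrow> \<Gamma> \<turnstile> Lam A b \<doteq> Lam A' b' \<Colon> Pi A B"
| pi_elim_eq: "\<lbrakk>\<Gamma> \<turnstile> f \<doteq> f' \<Colon> Pi A B; \<Gamma> \<turnstile> a \<doteq> a' \<Colon> A\<rbrakk> \<Longrightarrow> \<Gamma> \<turnstile> App f a \<doteq> App f' a' \<Colon> inst1 B a"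

| sig_form: "\<lbrakk>\<Gamma> \<turnstile> A \<Colon> Univ i; A # \<Gamma> \<turnstile> B \<Colon> Univ i\<rbrakk> \<Longrightarrow> \<Gamma> \<turnstile> Sig A B \<Colon> Univ i"
| sig_intro: "\<lbrakk>A # \<Gamma> \<turnstile> B \<Colon> Univ i; \<Gamma> \<turnstile> a \<Colon> A; \<Gamma> \<turnstile> b \<Colon> inst1 B a\<rbrakk> \<Longrightarrow> \<Gamma> \<turnstile> Pr a b \<Colon> Sig A B"
| sig_elim:
    "\<lbrakk>Sig A B # \<Gamma> \<turnstile> C \<Colon> Univ i; B # A # \<Gamma> \<turnstile> g \<Colon> sub (Pr (Var 1) (Var 0) \<cdot> shift 2) C;
      \<Gamma> \<turnstile> p \<Colon> Sig A B\<rbrakk> \<Longrightarrow> \<Gamma> \<turnstile> SigInd C g p \<Colon> inst1 C p"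
| sig_comp:
    "\<lbrakk>Sig A B # \<Gamma> \<turnstile> C \<Colon> Univ i; B # A # \<Gamma> \<turnstile> g \<Colon> sub (Pr (Var 1) (Var 0) \<cdot> shift 2) C;
      \<Gamma> \<turnstile> a \<Colon> A; \<Gamma> \<turnstile> b \<Colon> inst1 B a\<rbrakk>
     \<Longrightarrow> \<Gamma> \<turnstile> SigInd C g (Pr a b) \<doteq> inst2 g a b \<Colon> inst1 C (Pr a b)"
| sig_form_eq: "\<lbrakk>\<Gamma> \<turnstile> A \<doteq> A' \<Colon> Univ i; A # \<Gamma> \<turnstile> B \<doteq> B' \<Colon> Univ i\<rbrakk> \<Longrightarrow> \<Gamma> \<turnstile> Sig A B \<doteq> Sig A' B' \<Colon> Univ i"
| sig_intro_eq:
    "\<lbrakk>A # \<Gamma> \<turnstile> B \<Colon> Univ i; \<Gamma> \<turnstile> a \<doteq> a' \<Colon> A; \<Gamma> \<turnstile> b \<doteq> b' \<Colon> inst1 B a\<rbrakk>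
     \<Longrightarrow> \<Gamma> \<turnstile> Pr a b \<doteq> Pr a' b' \<Colon> Sig A B"
| sig_elim_eq:
    "\<lbrakk>Sig A B # \<Gamma> \<turnstile> C \<doteq> C' \<Colon> Univ i; B # A # \<Gamma> \<turnstile> g \<doteq> g' \<Colon> sub (Pr (Var 1) (Var 0) \<cdot> shift 2) C;
      \<Gamma> \<turnstile> p \<doteq> p' \<Colon> Sig A B\<rbrakk> \<Longrightarrow> \<Gamma> \<turnstile> SigInd C g p \<doteq> SigInd C' g' p' \<Colon> inst1 C p"

| coprod_form: "\<lbrakk>\<Gamma> \<turnstile> A \<Colon> Univ i; \<Gamma> \<turnstile> B \<Colon> Univ i\<rbrakk> \<Longrightarrow> \<Gamma> \<turnstile> Coprod A B \<Colon> Univ i"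
| coprod_intro1: "\<lbrakk>\<Gamma> \<turnstile> A \<Colon> Univ i; \<Gamma> \<turnstile> B \<Colon> Univ i; \<Gamma> \<turnstile> a \<Colon> A\<rbrakk> \<Longrightarrow> \<Gamma> \<turnstile> InL a \<Colon> Coprod A B"
| coprod_intro2: "\<lbrakk>\<Gamma> \<turnstile> A \<Colon> Univ i; \<Gamma> \<turnstile> B \<Colon> Univ i; \<Gamma> \<turnstile> b \<Colon> B\<rbrakk> \<Longrightarrow> \<Gamma> \<turnstile> InR b \<Colon> Coprod A B"
| coprod_elim:
    "\<lbrakk>Coprod A B # \<Gamma> \<turnstile> C \<Colon> Univ i;
      A # \<Gamma> \<turnstile> c \<Colon> sub (InL (Var 0) \<cdot> shift 1) C; B # \<Gamma> \<turnstile> d \<Colon> sub (InR (Var 0) \<cdot> shift 1) C;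
      \<Gamma> \<turnstile> e \<Colon> Coprod A B\<rbrakk> \<Longrightarrow> \<Gamma> \<turnstile> CoprodInd C c d e \<Colon> inst1 C e"
| coprod_comp1:
    "\<lbrakk>Coprod A B # \<Gamma> \<turnstile> C \<Colon> Univ i;
      A # \<Gamma> \<turnstile> c \<Colon> sub (InL (Var 0) \<cdot> shift 1) C; B # \<Gamma> \<turnstile> d \<Colon> sub (InR (Var 0) \<cdot> shift 1) C;
      \<Gamma> \<turnstile> a \<Colon> A\<rbrakk> \<Longrightarrow> \<Gamma> \<turnstile> CoprodInd C c d (InL a) \<doteq> inst1 c a \<Colon> inst1 C (InL a)"
| coprod_comp2:
    "\<lbrakk>Coprod A B # \<Gamma> \<turnstile> C \<Colon> Univ i;
      A # \<Gamma> \<turnstile> c \<Colon> sub (InL (Var 0) \<cdot> shift 1) C; B # \<Gamma> \<turnstile> d \<Colon> sub (InR (Var 0) \<cdot> shift 1) C;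
      \<Gamma> \<turnstile> b \<Colon> B\<rbrakk> \<Longrightarrow> \<Gamma> \<turnstile> CoprodInd C c d (InR b) \<doteq> inst1 d b \<Colon> inst1 C (InR b)"
| coprod_form_eq:
    "\<lbrakk>\<Gamma> \<turnstile> A \<doteq> A' \<Colon> Univ i; \<Gamma> \<turnstile> B \<doteq> B' \<Colon> Univ i\<rbrakk> \<Longrightarrow> \<Gamma> \<turnstile> Coprod A B \<doteq> Coprod A' B' \<Colon> Univ i"
| coprod_intro1_eq:
    "\<lbrakk>\<Gamma> \<turnstile> A \<Colon> Univ i; \<Gamma> \<turnstile> B \<Colon> Univ i; \<Gamma> \<turnstile> a \<doteq> a' \<Colon> A\<rbrakk> \<Longrightarrow> \<Gamma> \<turnstile> InL a \<doteq> InL a' \<Colon> Coprod A B"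
| coprod_intro2_eq:
    "\<lbrakk>\<Gamma> \<turnstile> A \<Colon> Univ i; \<Gamma> \<turnstile> B \<Colon> Univ i; \<Gamma> \<turnstile> b \<doteq> b' \<Colon> B\<rbrakk> \<Longrightarrow> \<Gamma> \<turnstile> InR b \<doteq> InR b' \<Colon> Coprod A B"
| coprod_elim_eq:
    "\<lbrakk>Coprod A B # \<Gamma> \<turnstile> C \<doteq> C' \<Colon> Univ i;
      A # \<Gamma> \<turnstile> c \<doteq> c' \<Colon> sub (InL (Var 0) \<cdot> shift 1) C;
      B # \<Gamma> \<turnstile> d \<doteq> d' \<Colon> sub (InR (Var 0) \<cdot> shift 1) C; \<Gamma> \<turnstile> e \<doteq> e' \<Colon> Coprod A B\<rbrakk>
     \<Longrightarrow> \<Gamma> \<turnstile> CoprodInd C c d e \<doteq> CoprodInd C' c' d' e' \<Colon> inst1 C e"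

| empty_form: "wf_ctx \<Gamma> \<Longrightarrow> \<Gamma> \<turnstile> EmptyT \<Colon> Univ i"
| empty_elim: "\<lbrakk>EmptyT # \<Gamma> \<turnstile> C \<Colon> Univ i; \<Gamma> \<turnstile> a \<Colon> EmptyT\<rbrakk> \<Longrightarrow> \<Gamma> \<turnstile> EmptyInd C a \<Colon> inst1 C a"
| empty_elim_eq:
    "\<lbrakk>EmptyT # \<Gamma> \<turnstile> C \<doteq> C' \<Colon> Univ i; \<Gamma> \<turnstile> a \<doteq> a' \<Colon> EmptyT\<rbrakk>
     \<Longrightarrow> \<Gamma> \<turnstile> EmptyInd C a \<doteq> EmptyInd C' a' \<Colon> inst1 C a"

| unit_form: "wf_ctx \<Gamma> \<Longrightarrow> \<Gamma> \<turnstile> UnitT \<Colon> Univ i"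
| unit_intro: "wf_ctx \<Gamma> \<Longrightarrow> \<Gamma> \<turnstile> Star \<Colon> UnitT"
| unit_elim:
    "\<lbrakk>UnitT # \<Gamma> \<turnstile> C \<Colon> Univ i; \<Gamma> \<turnstile> c \<Colon> inst1 C Star; \<Gamma> \<turnstile> a \<Colon> UnitT\<rbrakk>
     \<Longrightarrow> \<Gamma> \<turnstile> UnitInd C c a \<Colon> inst1 C a"
| unit_comp:
    "\<lbrakk>UnitT # \<Gamma> \<turnstile> C \<Colon> Univ i; \<Gamma> \<turnstile> c \<Colon> inst1 C Star\<rbrakk>
     \<Longrightarrow> \<Gamma> \<turnstile> UnitInd C c Star \<doteq> c \<Colon> inst1 C Star"
| unit_elim_eq:
    "\<lbrakk>UnitT # \<Gamma> \<turnstile> C \<doteq> C' \<Colon> Univ i; \<Gamma> \<turnstile> c \<doteq> c' \<Colon> inst1 C Star; \<Gamma> \<turnstile> a \<doteq> a' \<Colon> UnitT\<rbrakk>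
     \<Longrightarrow> \<Gamma> \<turnstile> UnitInd C c a \<doteq> UnitInd C' c' a' \<Colon> inst1 C a"

| nat_form: "wf_ctx \<Gamma> \<Longrightarrow> \<Gamma> \<turnstile> NatT \<Colon> Univ i"
| nat_intro1: "wf_ctx \<Gamma> \<Longrightarrow> \<Gamma> \<turnstile> Zero \<Colon> NatT"
| nat_intro2: "\<Gamma> \<turnstile> n \<Colon> NatT \<Longrightarrow> \<Gamma> \<turnstile> Succ n \<Colon> NatT"
| nat_elim:
    "\<lbrakk>NatT # \<Gamma> \<turnstile> C \<Colon> Univ i; \<Gamma> \<turnstile> c \<Colon> inst1 C Zero;
      C # NatT # \<Gamma> \<turnstile> d \<Colon> sub (Succ (Var 1) \<cdot> shift 2) C; \<Gamma> \<turnstile> n \<Colon> NatT\<rbrakk>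
     \<Longrightarrow> \<Gamma> \<turnstile> NatInd C c d n \<Colon> inst1 C n"
| nat_comp1:
    "\<lbrakk>NatT # \<Gamma> \<turnstile> C \<Colon> Univ i; \<Gamma> \<turnstile> c \<Colon> inst1 C Zero;
      C # NatT # \<Gamma> \<turnstile> d \<Colon> sub (Succ (Var 1) \<cdot> shift 2) C\<rbrakk>
     \<Longrightarrow> \<Gamma> \<turnstile> NatInd C c d Zero \<doteq> c \<Colon> inst1 C Zero"
| nat_comp2:
    "\<lbrakk>NatT # \<Gamma> \<turnstile> C \<Colon> Univ i; \<Gamma> \<turnstile> c \<Colon> inst1 C Zero;
      C # NatT # \<Gamma> \<turnstile> d \<Colon> sub (Succ (Var 1) \<cdot> shift 2) C; \<Gamma> \<turnstile> n \<Colon> NatT\<rbrakk>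
     \<Longrightarrow> \<Gamma> \<turnstile> NatInd C c d (Succ n) \<doteq> inst2 d n (NatInd C c d n) \<Colon> inst1 C (Succ n)"
| nat_intro2_eq: "\<Gamma> \<turnstile> n \<doteq> n' \<Colon> NatT \<Longrightarrow> \<Gamma> \<turnstile> Succ n \<doteq> Succ n' \<Colon> NatT"
| nat_elim_eq:
    "\<lbrakk>NatT # \<Gamma> \<turnstile> C \<doteq> C' \<Colon> Univ i; \<Gamma> \<turnstile> c \<doteq> c' \<Colon> inst1 C Zero;
      C # NatT # \<Gamma> \<turnstile> d \<doteq> d' \<Colon> sub (Succ (Var 1) \<cdot> shift 2) C; \<Gamma> \<turnstile> n \<doteq> n' \<Colon> NatT\<rbrakk>
     \<Longrightarrow> \<Gamma> \<turnstile> NatInd C c d n \<doteq> NatInd C' c' d' n' \<Colon> inst1 C n"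

| id_form: "\<lbrakk>\<Gamma> \<turnstile> A \<Colon> Univ i; \<Gamma> \<turnstile> a \<Colon> A; \<Gamma> \<turnstile> b \<Colon> A\<rbrakk> \<Longrightarrow> \<Gamma> \<turnstile> IdT A a b \<Colon> Univ i"
| id_intro: "\<lbrakk>\<Gamma> \<turnstile> A \<Colon> Univ i; \<Gamma> \<turnstile> a \<Colon> A\<rbrakk> \<Longrightarrow> \<Gamma> \<turnstile> Refl a \<Colon> IdT A a a"
| id_elim:
    "\<lbrakk>IdT (wk 2 A) (Var 1) (Var 0) # wk 1 A # A # \<Gamma> \<turnstile> C \<Colon> Univ i;
      A # \<Gamma> \<turnstile> c \<Colon> sub (Refl (Var 0) \<cdot> Var 0 \<cdot> Var 0 \<cdot> shift 1) C;
      \<Gamma> \<turnstile> a \<Colon> A; \<Gamma> \<turnstile> b \<Colon> A; \<Gamma> \<turnstile> p \<Colon> IdT A a b\<rbrakk>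
     \<Longrightarrow> \<Gamma> \<turnstile> IdInd C c a b p \<Colon> inst3 C a b p"
| id_comp:
    "\<lbrakk>IdT (wk 2 A) (Var 1) (Var 0) # wk 1 A # A # \<Gamma> \<turnstile> C \<Colon> Univ i;
      A # \<Gamma> \<turnstile> c \<Colon> sub (Refl (Var 0) \<cdot> Var 0 \<cdot> Var 0 \<cdot> shift 1) C; \<Gamma> \<turnstile> a \<Colon> A\<rbrakk>
     \<Longrightarrow> \<Gamma> \<turnstile> IdInd C c a a (Refl a) \<doteq> inst1 c a \<Colon> inst3 C a a (Refl a)"
| id_form_eq:
    "\<lbrakk>\<Gamma> \<turnstile> A \<doteq> A' \<Colon> Univ i; \<Gamma> \<turnstile> a \<doteq> a' \<Colon> A; \<Gamma> \<turnstile> b \<doteq> b' \<Colon> A\<rbrakk>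
     \<Longrightarrow> \<Gamma> \<turnstile> IdT A a b \<doteq> IdT A' a' b' \<Colon> Univ i"
| id_intro_eq: "\<lbrakk>\<Gamma> \<turnstile> A \<Colon> Univ i; \<Gamma> \<turnstile> a \<doteq> a' \<Colon> A\<rbrakk> \<Longrightarrow> \<Gamma> \<turnstile> Refl a \<doteq> Refl a' \<Colon> IdT A a a"
| id_elim_eq:
    "\<lbrakk>IdT (wk 2 A) (Var 1) (Var 0) # wk 1 A # A # \<Gamma> \<turnstile> C \<doteq> C' \<Colon> Univ i;
      A # \<Gamma> \<turnstile> c \<doteq> c' \<Colon> sub (Refl (Var 0) \<cdot> Var 0 \<cdot> Var 0 \<cdot> shift 1) C;
      \<Gamma> \<turnstile> a \<doteq> a' \<Colon> A; \<Gamma> \<turnstile> b \<doteq> b' \<Colon> A; \<Gamma> \<turnstile> p \<doteq> p' \<Colon> IdT A a b\<rbrakk>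
     \<Longrightarrow> \<Gamma> \<turnstile> IdInd C c a b p \<doteq> IdInd C' c' a' b' p' \<Colon> inst3 C a b p"

definition arrow :: "tm \<Rightarrow> tm \<Rightarrow> tm" where
  "arrow A B = Pi A (wk 1 B)"

text \<open>\<open>\<Prod>(x y : X). \<Prod>(p q : x = y). p = q\<close>\<close>

definition is_set :: "tm \<Rightarrow> tm" where
  "is_set X =
     Pi X (Pi (wk 1 X) (Pi (IdT (wk 2 X) (Var 1) (Var 0)) (Pi (IdT (wk 3 X) (Var 2) (Var 1))
       (IdT (IdT (wk 4 X) (Var 3) (Var 2)) (Var 1) (Var 0)))))"

text \<open>\<open>\<Prod>(x : X). f (f x) = f x\<close>\<close>

definition idempotence :: "tm \<Rightarrow> tm \<Rightarrow> tm" where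
  "idempotence X f =
     Pi X (IdT (wk 1 X) (App (wk 1 f) (App (wk 1 f) (Var 0))) (App (wk 1 f) (Var 0)))"

text \<open>\<open>\<Sum>(A : U\<^sub>i). \<Sum>(r : X \<rightarrow> A). \<Sum>(s : A \<rightarrow> X). \<Sum>(H : \<Prod>(a : A). r (s a) = a). \<Prod>(x : X). s (r x) = f x\<close>\<close>

definition splitting :: "nat \<Rightarrow> tm \<Rightarrow> tm \<Rightarrow> tm" where
  "splitting i X f =
     Sig (Univ i)
      (Sig (arrow (wk 1 X) (Var 0))
        (Sig (arrow (Var 1) (wk 2 X))
          (Sig (Pi (Var 2) (IdT (Var 3) (App (Var 2) (App (Var 1) (Var 0))) (Var 0)))
            (Pi (wk 4 X)
              (IdT (wk 5 X) (App (Var 2) (App (Var 3) (Var 0))) (App (wk 5 f) (Var 0)))))))"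

end

theory Submission
  imports Defs
begin

text \<open>
  \<open>f\<close> splits through its type of fixed points \<open>A = \<Sum>(x : X). f x = x\<close>, with \<open>r x = (f x, I x)\<close> and
  \<open>s\<close> the first projection.  Then \<open>s (r x)\<close> is judgementally \<open>f x\<close>, and \<open>r (s (x, p))\<close> is
  judgementally \<open>(f x, I x)\<close>, so it remains to identify \<open>(f x, I x)\<close> with \<open>(x, p)\<close>.  The path
  \<open>p : f x = x\<close> connects the first components, and since \<open>X\<close> is a set, \<open>f x = x\<close> is a proposition
  for every \<open>x\<close>; pairs in a \<open>\<Sum>\<close>-type of propositions are equal as soon as their first components
  are.
\<close>

section \<open>Renaming and substitution\<close>

lemma scons_simps [simp]: "(a \<cdot> \<sigma>) 0 = a" "(a \<cdot> \<sigma>) (Suc n) = \<sigma> n"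
  by (simp_all add: scons_def)

lemma shift_eq [simp]: "shift k = (\<lambda>n. Var (n + k))"
  by (simp add: fun_eq_iff shift_def)

lemma up_simps [simp]: "up \<sigma> 0 = Var 0" "up \<sigma> (Suc n) = wk 1 (\<sigma> n)"
  by (simp_all add: up_def)

lemma up_ren_simps [simp]: "up_ren \<rho> 0 = 0" "up_ren \<rho> (Suc n) = Suc (\<rho> n)"
  by (simp_all add: up_ren_def)

lemma nat_fun_eqI:
  fixes \<sigma> \<tau> :: "nat \<Rightarrow> 'a"
  assumes "\<sigma> 0 = \<tau> 0" "\<And>n. \<sigma> (Suc n) = \<tau> (Suc n)"
  shows "\<sigma> = \<tau>"
proof
  show "\<sigma> n = \<tau> n" for n using assms by (cases n) simp_all
qed

lemma up_Var_comp [simp]: "up (\<lambda>n. Var (\<rho> n)) = (\<lambda>n. Var (up_ren \<rho> n))"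
  by (rule nat_fun_eqI) simp_all

lemma up_comp_up_ren [simp]: "(\<lambda>n. up \<sigma> (up_ren \<rho> n)) = up (\<lambda>n. \<sigma> (\<rho> n))"
  by (rule nat_fun_eqI) simp_all

lemma up_ren_comp [simp]: "(\<lambda>n. up_ren \<rho> (up_ren \<rho>' n)) = up_ren (\<lambda>n. \<rho> (\<rho>' n))"
  by (rule nat_fun_eqI) simp_all

lemma sub_Var_comp [simp]: "sub (\<lambda>n. Var (\<rho> n)) t = ren \<rho> t"
  by (induction t arbitrary: \<rho>) simp_all

lemma sub_ren [simp]: "sub \<sigma> (ren \<rho> t) = sub (\<lambda>n. \<sigma> (\<rho> n)) t"
  by (induction t arbitrary: \<sigma> \<rho>) simp_all

lemma ren_ren [simp]: "ren \<rho> (ren \<rho>' t) = ren (\<lambda>n. \<rho> (\<rho>' n)) t"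
  using sub_ren[of "\<lambda>n. Var (\<rho> n)" \<rho>' t] by simp

lemma ren_up [simp]: "(\<lambda>n. ren (up_ren \<rho>) (up \<sigma> n)) = up (\<lambda>n. ren \<rho> (\<sigma> n))"
  by (rule nat_fun_eqI) simp_all

lemma ren_sub [simp]: "ren \<rho> (sub \<sigma> t) = sub (\<lambda>n. ren \<rho> (\<sigma> n)) t"
  by (induction t arbitrary: \<rho> \<sigma>) simp_all

lemma sub_up [simp]: "(\<lambda>n. sub (up \<tau>) (up \<sigma> n)) = up (\<lambda>n. sub \<tau> (\<sigma> n))"
  by (rule nat_fun_eqI) simp_all

lemma sub_sub [simp]: "sub \<tau> (sub \<sigma> t) = sub (\<lambda>n. sub \<tau> (\<sigma> n)) t"
  by (induction t arbitrary: \<tau> \<sigma>) simp_all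

lemma up_ren_id [simp]: "up_ren (\<lambda>n. n) = (\<lambda>n. n)"
  by (rule nat_fun_eqI) simp_all

lemma ren_id [simp]: "ren (\<lambda>n. n) t = t"
  by (induction t) simp_all

lemma scons_Var_Suc [simp]: "Var 0 \<cdot> (\<lambda>n. Var (Suc n)) = Var"
  by (rule nat_fun_eqI) simp_all

lemma scons_up_ren [simp]: "(\<lambda>n. (a \<cdot> \<sigma>) (up_ren \<rho> n)) = a \<cdot> (\<lambda>n. \<sigma> (\<rho> n))"
  by (rule nat_fun_eqI) simp_all

lemma ren_scons [simp]: "(\<lambda>n. ren \<rho> ((a \<cdot> \<sigma>) n)) = ren \<rho> a \<cdot> (\<lambda>n. ren \<rho> (\<sigma> n))"
  by (rule nat_fun_eqI) simp_all

lemma sub_scons [simp]: "(\<lambda>n. sub \<tau> ((a \<cdot> \<sigma>) n)) = sub \<tau> a \<cdot> (\<lambda>n. sub \<tau> (\<sigma> n))"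
  by (rule nat_fun_eqI) simp_all

lemma sub_scons_up [simp]: "(\<lambda>n. sub (a \<cdot> \<tau>) (up \<sigma> n)) = a \<cdot> (\<lambda>n. sub \<tau> (\<sigma> n))"
  by (rule nat_fun_eqI) simp_all

lemma up_up_1: "up (up \<sigma>) 1 = Var 1"
  by simp

lemma sub_wk:
  "sub (up \<sigma>) (wk 1 t) = wk 1 (sub \<sigma> t)"
  "sub (up (up \<sigma>)) (wk 2 t) = wk 2 (sub \<sigma> t)"
  by simp_all

lemma sub_inst:
  "sub \<sigma> (inst1 C a) = inst1 (sub (up \<sigma>) C) (sub \<sigma> a)"
  "sub \<sigma> (inst2 C a b) = inst2 (sub (up (up \<sigma>)) C) (sub \<sigma> a) (sub \<sigma> b)"
  "sub \<sigma> (inst3 C a b c) = inst3 (sub (up (up (up \<sigma>))) C) (sub \<sigma> a) (sub \<sigma> b) (sub \<sigma> c)"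
  by simp_all

lemma sub_branch_type:
  "sub (up (up \<sigma>)) (sub (Pr (Var 1) (Var 0) \<cdot> shift 2) C) =
     sub (Pr (Var 1) (Var 0) \<cdot> shift 2) (sub (up \<sigma>) C)"
  "sub (up (up \<sigma>)) (sub (Succ (Var 1) \<cdot> shift 2) C) = sub (Succ (Var 1) \<cdot> shift 2) (sub (up \<sigma>) C)"
  "sub (up \<sigma>) (sub (InL (Var 0) \<cdot> shift 1) C) = sub (InL (Var 0) \<cdot> shift 1) (sub (up \<sigma>) C)"
  "sub (up \<sigma>) (sub (InR (Var 0) \<cdot> shift 1) C) = sub (InR (Var 0) \<cdot> shift 1) (sub (up \<sigma>) C)"
  "sub (up \<sigma>) (sub (Refl (Var 0) \<cdot> Var 0 \<cdot> Var 0 \<cdot> shift 1) C) =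
     sub (Refl (Var 0) \<cdot> Var 0 \<cdot> Var 0 \<cdot> shift 1) (sub (up (up (up \<sigma>))) C)"
  by (simp_all add: eval_nat_numeral)

section \<open>Admissibility of substitution\<close>

inductive_cases wf_ctx_ConsE [elim!]: "wf_ctx (A # \<Gamma>)"

lemma wf_ctx_of_has_type: "\<Gamma> \<turnstile> a \<Colon> A \<Longrightarrow> wf_ctx \<Gamma>"
  and "\<Gamma> \<turnstile> a \<doteq> b \<Colon> A \<Longrightarrow> wf_ctx \<Gamma>"
  by (induction rule: wf_ctx_has_type_judg_eq.inducts(2,3)[where ?P1.0 = "\<lambda>_. True"]) auto

lemma wf_ctx_Cons: "\<Gamma> \<turnstile> A \<Colon> Univ i \<Longrightarrow> wf_ctx (A # \<Gamma>)"
  by (rule ctx_ext[OF wf_ctx_of_has_type])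

text \<open>
  Lifting a substitution under a binder requires weakening its entries.  Admissibility is therefore
  proved for any class of substitutions that is closed under lifting, and used first for renamings,
  which provide weakening, and then for all well-typed substitutions.
\<close>

locale substitution_class =
  fixes S :: "tm list \<Rightarrow> (nat \<Rightarrow> tm) \<Rightarrow> tm list \<Rightarrow> bool"
  assumes wf: "S \<Delta> \<sigma> \<Gamma> \<Longrightarrow> wf_ctx \<Delta>"
    and lookup: "\<lbrakk>S \<Delta> \<sigma> \<Gamma>; n < length \<Gamma>\<rbrakk> \<Longrightarrow> \<Delta> \<turnstile> \<sigma> n \<Colon> sub \<sigma> (wk (Suc n) (\<Gamma> ! n))"
    and lift: "\<lbrakk>S \<Delta> \<sigma> \<Gamma>; \<Delta> \<turnstile> sub \<sigma> A \<Colon> Univ i\<rbrakk> \<Longrightarrow> S (sub \<sigma> A # \<Delta>) (up \<sigma>) (A # \<Gamma>)"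
begin

text \<open>
  A premise such as \<open>A # \<Gamma> \<turnstile> b \<Colon> B\<close> does not come with a derivation of \<open>\<Gamma> \<turnstile> A \<Colon> Univ i\<close>, so the
  induction also carries along that the entries of the context stay types under substitution.
\<close>

primrec stable_ctx :: "tm list \<Rightarrow> bool" where
  "stable_ctx [] \<longleftrightarrow> True"
| "stable_ctx (A # \<Gamma>) \<longleftrightarrow> stable_ctx \<Gamma> \<and> (\<exists>i. \<forall>\<Delta> \<sigma>. S \<Delta> \<sigma> \<Gamma> \<longrightarrow> \<Delta> \<turnstile> sub \<sigma> A \<Colon> Univ i)"

definition stable :: "tm list \<Rightarrow> (tm list \<Rightarrow> (nat \<Rightarrow> tm) \<Rightarrow> bool) \<Rightarrow> bool" where
  "stable \<Gamma> J \<longleftrightarrow> stable_ctx \<Gamma> \<and> (\<forall>\<Delta> \<sigma>. S \<Delta> \<sigma> \<Gamma> \<longrightarrow> J \<Delta> \<sigma>)"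

lemma stable_bound:
  assumes "stable (A # \<Gamma>) J"
  shows "stable \<Gamma> (\<lambda>\<Delta> \<sigma>. J (sub \<sigma> A # \<Delta>) (up \<sigma>))"
  using assms lift unfolding stable_def by fastforce

lemmas conversion_and_universe_rules = wf_ctx_has_type_judg_eq.intros(4-11)
lemmas type_former_rules = wf_ctx_has_type_judg_eq.intros(12-)

lemma
  shows stable_wf_ctx: "wf_ctx \<Gamma> \<Longrightarrow> stable_ctx \<Gamma>"
    and stable_has_type: "\<Gamma> \<turnstile> a \<Colon> A \<Longrightarrow> stable \<Gamma> (\<lambda>\<Delta> \<sigma>. \<Delta> \<turnstile> sub \<sigma> a \<Colon> sub \<sigma> A)"
    and stable_judg_eq: "\<Gamma> \<turnstile> a \<doteq> b \<Colon> A \<Longrightarrow>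
      stable \<Gamma> (\<lambda>\<Delta> \<sigma>. \<Delta> \<turnstile> sub \<sigma> a \<doteq> sub \<sigma> b \<Colon> sub \<sigma> A)"
  by (induction rule: wf_ctx_has_type_judg_eq.inducts, safe dest!: stable_bound,
      simp_all only: stable_def stable_ctx.simps sub.simps sub_inst sub_wk sub_branch_type up_simps
        up_up_1 simp_thms)
    ((((intro allI impI)?, (elim conjE)?, rule type_former_rules; blast intro: wf)
      | blast intro: wf lookup conversion_and_universe_rules)[1])+

end

definition renaming :: "tm list \<Rightarrow> (nat \<Rightarrow> nat) \<Rightarrow> tm list \<Rightarrow> bool" where
  "renaming \<Delta> \<rho> \<Gamma> \<longleftrightarrow> wf_ctx \<Delta> \<and>
    (\<forall>n < length \<Gamma>. \<rho> n < length \<Delta> \<and> wk (Suc (\<rho> n)) (\<Delta> ! \<rho> n) = ren \<rho> (wk (Suc n) (\<Gamma> ! n)))"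

lemma renaming_wf: "renaming \<Delta> \<rho> \<Gamma> \<Longrightarrow> wf_ctx \<Delta>"
  by (simp add: renaming_def)

lemma renaming_up:
  assumes "renaming \<Delta> \<rho> \<Gamma>" "\<Delta> \<turnstile> ren \<rho> A \<Colon> Univ i"
  shows "renaming (ren \<rho> A # \<Delta>) (up_ren \<rho>) (A # \<Gamma>)"
  unfolding renaming_def
proof (intro conjI allI impI)
  show "wf_ctx (ren \<rho> A # \<Delta>)"
    using assms by (blast intro: ctx_ext renaming_wf)
  fix n assume n: "n < length (A # \<Gamma>)"
  show "up_ren \<rho> n < length (ren \<rho> A # \<Delta>)"
    using assms(1) n by (cases n) (simp_all add: renaming_def)
  show "wk (Suc (up_ren \<rho> n)) ((ren \<rho> A # \<Delta>) ! up_ren \<rho> n) =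
      ren (up_ren \<rho>) (wk (Suc n) ((A # \<Gamma>) ! n))"
  proof (cases n)
    case (Suc m)
    then have "wk (Suc (\<rho> m)) (\<Delta> ! \<rho> m) = ren \<rho> (wk (Suc m) (\<Gamma> ! m))"
      using assms(1) n by (simp add: renaming_def)
    from arg_cong[OF this, of "wk 1"] Suc show ?thesis by simp
  qed simp
qed

lemma renaming_wk: "wf_ctx (\<Delta> @ \<Gamma>) \<Longrightarrow> renaming (\<Delta> @ \<Gamma>) (\<lambda>n. n + length \<Delta>) \<Gamma>"
  by (auto simp: renaming_def nth_append ac_simps)

interpretation renamings: substitution_class "\<lambda>\<Delta> \<sigma> \<Gamma>. \<exists>\<rho>. \<sigma> = (\<lambda>n. Var (\<rho> n)) \<and> renaming \<Delta> \<rho> \<Gamma>"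
proof
  fix \<Delta> \<sigma> \<Gamma>
  assume "\<exists>\<rho>. \<sigma> = (\<lambda>n. Var (\<rho> n)) \<and> renaming \<Delta> \<rho> \<Gamma>"
  then obtain \<rho> where \<sigma>: "\<sigma> = (\<lambda>n. Var (\<rho> n))" and \<rho>: "renaming \<Delta> \<rho> \<Gamma>" by blast
  show "wf_ctx \<Delta>" using \<rho> by (rule renaming_wf)
  show "\<Delta> \<turnstile> \<sigma> n \<Colon> sub \<sigma> (wk (Suc n) (\<Gamma> ! n))" if "n < length \<Gamma>" for n
    using \<rho> that var[of \<Delta> "\<rho> n"] unfolding \<sigma> renaming_def by simp
  show "\<exists>\<rho>'. up \<sigma> = (\<lambda>n. Var (\<rho>' n)) \<and> renaming (sub \<sigma> A # \<Delta>) \<rho>' (A # \<Gamma>)"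
    if "\<Delta> \<turnstile> sub \<sigma> A \<Colon> Univ i" for A i
    using renaming_up[OF \<rho>] that unfolding \<sigma> by auto
qed

theorem ren_has_type: "\<lbrakk>\<Gamma> \<turnstile> a \<Colon> A; renaming \<Delta> \<rho> \<Gamma>\<rbrakk> \<Longrightarrow> \<Delta> \<turnstile> ren \<rho> a \<Colon> ren \<rho> A"
  using renamings.stable_has_type[of \<Gamma> a A] unfolding renamings.stable_def by fastforce

lemma renaming_up_ctx:
  assumes "renaming \<Delta> \<rho> \<Gamma>" "wf_ctx (A # \<Gamma>)"
  shows "renaming (ren \<rho> A # \<Delta>) (up_ren \<rho>) (A # \<Gamma>)"
proof -
  obtain i where "\<Gamma> \<turnstile> A \<Colon> Univ i"
    using assms(2) by blast
  from renaming_up[OF assms(1)] ren_has_type[OF this assms(1)] show ?thesis by simp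
qed

lemma ren_up_has_type:
  assumes "A # \<Gamma> \<turnstile> b \<Colon> B" "renaming \<Delta> \<rho> \<Gamma>"
  shows "ren \<rho> A # \<Delta> \<turnstile> ren (up_ren \<rho>) b \<Colon> ren (up_ren \<rho>) B"
  by (rule ren_has_type[OF assms(1) renaming_up_ctx[OF assms(2) wf_ctx_of_has_type[OF assms(1)]]])

lemma renaming_Cons: "wf_ctx (B # \<Gamma>) \<Longrightarrow> renaming (B # \<Gamma>) (\<lambda>n. n + 1) \<Gamma>"
  using renaming_wk[of "[B]" \<Gamma>] by simp

lemma wk_has_type: "\<lbrakk>\<Gamma> \<turnstile> a \<Colon> A; wf_ctx (B # \<Gamma>)\<rbrakk> \<Longrightarrow> B # \<Gamma> \<turnstile> wk 1 a \<Colon> wk 1 A"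
  by (rule ren_has_type[OF _ renaming_Cons])

definition substitution :: "tm list \<Rightarrow> (nat \<Rightarrow> tm) \<Rightarrow> tm list \<Rightarrow> bool" where
  "substitution \<Delta> \<sigma> \<Gamma> \<longleftrightarrow> wf_ctx \<Delta> \<and> (\<forall>n < length \<Gamma>. \<Delta> \<turnstile> \<sigma> n \<Colon> sub \<sigma> (wk (Suc n) (\<Gamma> ! n)))"

interpretation substitutions: substitution_class substitution
proof
  fix \<Delta> \<sigma> \<Gamma>
  assume \<sigma>: "substitution \<Delta> \<sigma> \<Gamma>"
  then show "wf_ctx \<Delta>" by (simp add: substitution_def)
  show "\<Delta> \<turnstile> \<sigma> n \<Colon> sub \<sigma> (wk (Suc n) (\<Gamma> ! n))" if "n < length \<Gamma>" for n
    using \<sigma> that by (simp add: substitution_def)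
  fix A i
  assume "\<Delta> \<turnstile> sub \<sigma> A \<Colon> Univ i"
  with \<open>wf_ctx \<Delta>\<close> have wf: "wf_ctx (sub \<sigma> A # \<Delta>)" by (rule ctx_ext)
  have "sub \<sigma> A # \<Delta> \<turnstile> up \<sigma> n \<Colon> sub (up \<sigma>) (wk (Suc n) ((A # \<Gamma>) ! n))"
    if n: "n < Suc (length \<Gamma>)" for n
  proof (cases n)
    case 0
    then show ?thesis using var[OF wf, of 0] by simp
  next
    case (Suc m)
    then have "\<Delta> \<turnstile> \<sigma> m \<Colon> sub \<sigma> (wk (Suc m) (\<Gamma> ! m))"
      using \<sigma> n by (simp add: substitution_def)
    from wk_has_type[OF this wf] Suc show ?thesis by simp
  qed
  with wf show "substitution (sub \<sigma> A # \<Delta>) (up \<sigma>) (A # \<Gamma>)"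
    by (simp add: substitution_def)
qed

theorem sub_has_type: "\<lbrakk>\<Gamma> \<turnstile> a \<Colon> A; substitution \<Delta> \<sigma> \<Gamma>\<rbrakk> \<Longrightarrow> \<Delta> \<turnstile> sub \<sigma> a \<Colon> sub \<sigma> A"
  using substitutions.stable_has_type unfolding substitutions.stable_def by blast

lemma inst1_has_type:
  assumes "A # \<Gamma> \<turnstile> b \<Colon> B" "\<Gamma> \<turnstile> a \<Colon> A"
  shows "\<Gamma> \<turnstile> inst1 b a \<Colon> inst1 B a"
proof (rule sub_has_type[OF assms(1)])
  have wf: "wf_ctx \<Gamma>" using assms(2) by (rule wf_ctx_of_has_type)
  have "\<Gamma> \<turnstile> (a \<cdot> shift 0) n \<Colon> sub (a \<cdot> shift 0) (wk (Suc n) ((A # \<Gamma>) ! n))"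
    if "n < Suc (length \<Gamma>)" for n
    using assms(2) var[OF wf] that by (cases n) simp_all
  with wf show "substitution \<Gamma> (a \<cdot> shift 0) (A # \<Gamma>)" by (simp add: substitution_def)
qed

section \<open>Derived rules\<close>

lemma ren_arrow [simp]: "ren \<rho> (arrow A B) = arrow (ren \<rho> A) (ren \<rho> B)"
  by (simp add: arrow_def)

lemma sub_arrow [simp]: "sub \<sigma> (arrow A B) = arrow (sub \<sigma> A) (sub \<sigma> B)"
  by (simp add: arrow_def)

lemma var_0: "wf_ctx (A # \<Gamma>) \<Longrightarrow> A # \<Gamma> \<turnstile> Var 0 \<Colon> wk 1 A"
  using var[of "A # \<Gamma>" 0] by simp

lemma var_of_type:
  assumes "wf_ctx \<Gamma>" "n < length \<Gamma>" "wk (Suc n) (\<Gamma> ! n) = A"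
  shows "\<Gamma> \<turnstile> Var n \<Colon> A"
  using var[OF assms(1,2)] assms(3) by simp

lemma pi_elim_of_type:
  assumes "\<Gamma> \<turnstile> f \<Colon> Pi A B" "\<Gamma> \<turnstile> a \<Colon> A" "inst1 B a = C"
  shows "\<Gamma> \<turnstile> App f a \<Colon> C"
  using pi_elim[OF assms(1,2)] assms(3) by simp

lemma wk_type:
  assumes "\<Gamma> \<turnstile> A \<Colon> Univ i" "\<Gamma> \<turnstile> B \<Colon> Univ j"
  shows "A # \<Gamma> \<turnstile> wk 1 B \<Colon> Univ j"
  using wk_has_type[OF assms(2) wf_ctx_Cons[OF assms(1)]] by simp

lemma wf_ctx_wk2:
  assumes "\<Gamma> \<turnstile> A \<Colon> Univ i" "\<Gamma> \<turnstile> B \<Colon> Univ j"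
  shows "wf_ctx (wk 1 B # A # \<Gamma>)"
  by (rule wf_ctx_Cons[OF wk_type[OF assms]])

lemma renaming_wk2:
  assumes "\<Gamma> \<turnstile> A \<Colon> Univ i" "\<Gamma> \<turnstile> B \<Colon> Univ j"
  shows "renaming (wk 1 B # A # \<Gamma>) (\<lambda>n. n + 2) \<Gamma>"
  using renaming_wk[of "[wk 1 B, A]"] wf_ctx_wk2[OF assms] by (simp add: eval_nat_numeral)

lemma arrow_form:
  assumes "\<Gamma> \<turnstile> A \<Colon> Univ i" "\<Gamma> \<turnstile> B \<Colon> Univ i"
  shows "\<Gamma> \<turnstile> arrow A B \<Colon> Univ i"
  unfolding arrow_def by (rule pi_form[OF assms(1) wk_type[OF assms]])

lemma arrow_intro: "A # \<Gamma> \<turnstile> b \<Colon> wk 1 B \<Longrightarrow> \<Gamma> \<turnstile> Lam A b \<Colon> arrow A B"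
  unfolding arrow_def by (rule pi_intro)

lemma arrow_elim: "\<lbrakk>\<Gamma> \<turnstile> f \<Colon> arrow A B; \<Gamma> \<turnstile> a \<Colon> A\<rbrakk> \<Longrightarrow> \<Gamma> \<turnstile> App f a \<Colon> B"
  unfolding arrow_def by (erule pi_elim_of_type) simp_all

lemma arrow_elim_eq:
  "\<lbrakk>\<Gamma> \<turnstile> f \<Colon> arrow A B; \<Gamma> \<turnstile> a \<doteq> a' \<Colon> A\<rbrakk> \<Longrightarrow> \<Gamma> \<turnstile> App f a \<doteq> App f a' \<Colon> B"
  unfolding arrow_def by (drule pi_elim_eq[OF eq_refl]) simp_all

lemma wk_arrow:
  "\<lbrakk>\<Gamma> \<turnstile> f \<Colon> arrow A B; wf_ctx (C # \<Gamma>)\<rbrakk> \<Longrightarrow> C # \<Gamma> \<turnstile> wk 1 f \<Colon> arrow (wk 1 A) (wk 1 B)"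
  using wk_has_type[of \<Gamma> f "arrow A B"] by simp

lemma ren_pair:
  assumes \<rho>: "renaming \<Delta> \<rho> \<Gamma>" and B: "A # \<Gamma> \<turnstile> B \<Colon> Univ i" and a: "\<Gamma> \<turnstile> a \<Colon> A"
    and b: "\<Delta> \<turnstile> b \<Colon> ren \<rho> (inst1 B a)"
  shows "\<Delta> \<turnstile> Pr (ren \<rho> a) b \<Colon> ren \<rho> (Sig A B)"
proof -
  have "ren \<rho> A # \<Delta> \<turnstile> ren (up_ren \<rho>) B \<Colon> Univ i"
    using ren_up_has_type[OF B \<rho>] by simp
  moreover have "\<Delta> \<turnstile> b \<Colon> inst1 (ren (up_ren \<rho>) B) (ren \<rho> a)"
    using b by simp
  ultimately show ?thesis
    using ren_has_type[OF a \<rho>] by (auto intro: sig_intro)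
qed

lemma pi_sig_intro:
  assumes C: "Sig A B # \<Gamma> \<turnstile> C \<Colon> Univ i"
    and g: "B # A # \<Gamma> \<turnstile> g \<Colon> sub (Pr (Var 1) (Var 0) \<cdot> shift 2) C"
  shows "\<exists>t. \<Gamma> \<turnstile> t \<Colon> Pi (Sig A B) C"
proof -
  let ?\<Delta> = "Sig A B # \<Gamma>" and ?\<rho> = "\<lambda>n. n + 1"
  have wf: "wf_ctx ?\<Delta>" using C by (rule wf_ctx_of_has_type)
  have \<rho>: "renaming ?\<Delta> ?\<rho> \<Gamma>" by (rule renaming_Cons[OF wf])
  have C': "Sig (ren ?\<rho> A) (ren (up_ren ?\<rho>) B) # ?\<Delta> \<turnstile> ren (up_ren ?\<rho>) C \<Colon> Univ i"
    using ren_up_has_type[OF C \<rho>] by simp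
  have "wf_ctx (A # \<Gamma>)" using wf_ctx_of_has_type[OF g] by blast
  note \<rho>A = renaming_up_ctx[OF \<rho> this]
  have "ren (up_ren ?\<rho>) B # ren ?\<rho> A # ?\<Delta> \<turnstile> ren (up_ren (up_ren ?\<rho>)) g \<Colon>
      sub (Pr (Var 1) (Var 0) \<cdot> shift 2) (ren (up_ren ?\<rho>) C)"
    using ren_up_has_type[OF g \<rho>A] by (simp add: eval_nat_numeral)
  moreover have "?\<Delta> \<turnstile> Var 0 \<Colon> Sig (ren ?\<rho> A) (ren (up_ren ?\<rho>) B)"
    using var_0[OF wf] by simp
  ultimately have "?\<Delta> \<turnstile> SigInd (ren (up_ren ?\<rho>) C) (ren (up_ren (up_ren ?\<rho>)) g) (Var 0) \<Colon> C"
    using sig_elim[OF C'] by fastforce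
  then show ?thesis by (blast intro: pi_intro)
qed

section \<open>Propositions and sets\<close>

lemma path_type_form:
  assumes A: "\<Gamma> \<turnstile> A \<Colon> Univ i"
  shows "wk 1 A # A # \<Gamma> \<turnstile> IdT (wk 2 A) (Var 1) (Var 0) \<Colon> Univ i"
proof -
  have "wk 1 A # A # \<Gamma> \<turnstile> wk 2 A \<Colon> Univ i"
    using ren_has_type[OF A renaming_wk2[OF A A]] by simp
  then show ?thesis
    by (intro id_form var_of_type[OF wf_ctx_wk2[OF A A]]) (simp_all add: eval_nat_numeral)
qed

definition is_prop :: "tm \<Rightarrow> tm" where
  "is_prop A = Pi A (Pi (wk 1 A) (IdT (wk 2 A) (Var 1) (Var 0)))"

lemma ren_is_prop [simp]: "ren \<rho> (is_prop A) = is_prop (ren \<rho> A)"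
  by (simp add: is_prop_def eval_nat_numeral)

lemma sub_is_prop [simp]: "sub \<sigma> (is_prop A) = is_prop (sub \<sigma> A)"
  by (simp add: is_prop_def eval_nat_numeral)

lemma is_prop_form: "\<Gamma> \<turnstile> A \<Colon> Univ i \<Longrightarrow> \<Gamma> \<turnstile> is_prop A \<Colon> Univ i"
  unfolding is_prop_def by (intro pi_form path_type_form wk_type)

lemma is_prop_elim:
  assumes "\<Gamma> \<turnstile> h \<Colon> is_prop A" "\<Gamma> \<turnstile> a \<Colon> A" "\<Gamma> \<turnstile> b \<Colon> A"
  shows "\<Gamma> \<turnstile> App (App h a) b \<Colon> IdT A a b"
proof -
  have "\<Gamma> \<turnstile> App h a \<Colon> Pi A (IdT (wk 1 A) (wk 1 a) (Var 0))"
    using assms(1) unfolding is_prop_def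
    by (rule pi_elim_of_type[OF _ assms(2)]) (simp add: eval_nat_numeral)
  then show ?thesis
    by (rule pi_elim_of_type[OF _ assms(3)]) simp
qed

lemma is_set_eq: "is_set A = Pi A (Pi (wk 1 A) (is_prop (IdT (wk 2 A) (Var 1) (Var 0))))"
  by (simp add: is_set_def is_prop_def eval_nat_numeral)

lemma ren_is_set [simp]: "ren \<rho> (is_set A) = is_set (ren \<rho> A)"
  by (simp add: is_set_eq eval_nat_numeral)

lemma is_set_form: "\<Gamma> \<turnstile> A \<Colon> Univ i \<Longrightarrow> \<Gamma> \<turnstile> is_set A \<Colon> Univ i"
  unfolding is_set_eq by (intro pi_form is_prop_form path_type_form wk_type)

lemma is_set_elim:
  assumes "\<Gamma> \<turnstile> h \<Colon> is_set A" "\<Gamma> \<turnstile> a \<Colon> A" "\<Gamma> \<turnstile> b \<Colon> A"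
  shows "\<Gamma> \<turnstile> App (App h a) b \<Colon> is_prop (IdT A a b)"
proof -
  have "\<Gamma> \<turnstile> App h a \<Colon> Pi A (is_prop (IdT (wk 1 A) (wk 1 a) (Var 0)))"
    using assms(1) unfolding is_set_eq
    by (rule pi_elim_of_type[OF _ assms(2)]) (simp add: eval_nat_numeral)
  then show ?thesis
    by (rule pi_elim_of_type[OF _ assms(3)]) simp
qed

section \<open>Path induction\<close>

abbreviation path_ctx :: "tm \<Rightarrow> tm list \<Rightarrow> tm list" where
  "path_ctx A \<Gamma> \<equiv> IdT (wk 2 A) (Var 1) (Var 0) # wk 1 A # A # \<Gamma>"

lemma wf_path_ctx: "\<Gamma> \<turnstile> A \<Colon> Univ i \<Longrightarrow> wf_ctx (path_ctx A \<Gamma>)"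
  by (intro wf_ctx_Cons path_type_form)

lemma path_ctx_vars:
  assumes "\<Gamma> \<turnstile> A \<Colon> Univ i"
  shows "path_ctx A \<Gamma> \<turnstile> Var 2 \<Colon> wk 3 A" "path_ctx A \<Gamma> \<turnstile> Var 1 \<Colon> wk 3 A"
  by (intro var_of_type[OF wf_path_ctx[OF assms]]; simp add: eval_nat_numeral)+

lemma renaming_path_ctx: "\<Gamma> \<turnstile> A \<Colon> Univ i \<Longrightarrow> renaming (path_ctx A \<Gamma>) (\<lambda>n. n + 3) \<Gamma>"
  using renaming_wk[of "[IdT (wk 2 A) (Var 1) (Var 0), wk 1 A, A]" \<Gamma>] wf_path_ctx
  by (simp add: eval_nat_numeral)

lemma id_ap:
  assumes A: "\<Gamma> \<turnstile> A \<Colon> Univ i" and B: "\<Gamma> \<turnstile> B \<Colon> Univ j" and t: "A # \<Gamma> \<turnstile> t \<Colon> wk 1 B"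
    and a: "\<Gamma> \<turnstile> a \<Colon> A" and b: "\<Gamma> \<turnstile> b \<Colon> A" and p: "\<Gamma> \<turnstile> p \<Colon> IdT A a b"
  shows "\<exists>q. \<Gamma> \<turnstile> q \<Colon> IdT B (inst1 t a) (inst1 t b)"
proof -
  let ?\<rho> = "\<lambda>n. n + 3" and ?\<Delta> = "path_ctx A \<Gamma>"
  let ?t = "ren (up_ren ?\<rho>) t"
  let ?C = "IdT (wk 3 B) (inst1 ?t (Var 2)) (inst1 ?t (Var 1))"
  note \<rho> = renaming_path_ctx[OF A]
  have "?\<Delta> \<turnstile> inst1 ?t (Var n) \<Colon> wk 3 B" if "?\<Delta> \<turnstile> Var n \<Colon> wk 3 A" for n
    using inst1_has_type[OF ren_up_has_type[OF t \<rho>] that] by (simp add: eval_nat_numeral)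
  then have C: "?\<Delta> \<turnstile> ?C \<Colon> Univ j"
    using ren_has_type[OF B \<rho>] path_ctx_vars[OF A] by (intro id_form) simp_all
  have "A # \<Gamma> \<turnstile> Refl t \<Colon> IdT (wk 1 B) t t"
    using wk_has_type[OF B wf_ctx_of_has_type[OF t]] t by (intro id_intro) simp_all
  then have "A # \<Gamma> \<turnstile> Refl t \<Colon> sub (Refl (Var 0) \<cdot> Var 0 \<cdot> Var 0 \<cdot> shift 1) ?C"
    by (simp add: eval_nat_numeral)
  from id_elim[OF C this a b p] show ?thesis
    by (auto simp: eval_nat_numeral)
qed

section \<open>Paths between pairs\<close>

lemma pair_eq_of_snd_eq:
  assumes A: "\<Gamma> \<turnstile> A \<Colon> Univ i" and B: "A # \<Gamma> \<turnstile> B \<Colon> Univ i" and a: "\<Gamma> \<turnstile> a \<Colon> A"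
    and b: "\<Gamma> \<turnstile> b \<Colon> inst1 B a" and b': "\<Gamma> \<turnstile> b' \<Colon> inst1 B a"
    and p: "\<Gamma> \<turnstile> p \<Colon> IdT (inst1 B a) b b'"
  shows "\<exists>q. \<Gamma> \<turnstile> q \<Colon> IdT (Sig A B) (Pr a b) (Pr a b')"
proof -
  have Ba: "\<Gamma> \<turnstile> inst1 B a \<Colon> Univ i"
    using inst1_has_type[OF B a] by simp
  then have wf: "wf_ctx (inst1 B a # \<Gamma>)"
    by (rule wf_ctx_Cons)
  have "inst1 B a # \<Gamma> \<turnstile> Pr (wk 1 a) (Var 0) \<Colon> wk 1 (Sig A B)"
    by (rule ren_pair[OF renaming_Cons[OF wf] B a var_0[OF wf]])
  from id_ap[OF Ba sig_form[OF A B] this b b' p] show ?thesis by simp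
qed

text \<open>
  Quantifying over the second components turns equality of pairs into a motive for path induction
  on \<open>x = y\<close> that needs no transport.
\<close>

definition pairs_over_eq :: "tm \<Rightarrow> tm \<Rightarrow> tm \<Rightarrow> tm \<Rightarrow> tm" where
  "pairs_over_eq A B x y = Pi (inst1 B x) (Pi (wk 1 (inst1 B y))
     (IdT (wk 2 (Sig A B)) (Pr (wk 2 x) (Var 1)) (Pr (wk 2 y) (Var 0))))"

lemma sub_pairs_over_eq [simp]:
  "sub \<sigma> (pairs_over_eq A B x y) = pairs_over_eq (sub \<sigma> A) (sub (up \<sigma>) B) (sub \<sigma> x) (sub \<sigma> y)"
  by (simp add: pairs_over_eq_def eval_nat_numeral)

lemma pairs_over_eq_form:
  assumes A: "\<Gamma> \<turnstile> A \<Colon> Univ i" and B: "A # \<Gamma> \<turnstile> B \<Colon> Univ i"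
    and x: "\<Gamma> \<turnstile> x \<Colon> A" and y: "\<Gamma> \<turnstile> y \<Colon> A"
  shows "\<Gamma> \<turnstile> pairs_over_eq A B x y \<Colon> Univ i"
proof -
  let ?\<Delta> = "wk 1 (inst1 B y) # inst1 B x # \<Gamma>"
  have Bx: "\<Gamma> \<turnstile> inst1 B x \<Colon> Univ i" and By: "\<Gamma> \<turnstile> inst1 B y \<Colon> Univ i"
    using inst1_has_type[OF B x] inst1_has_type[OF B y] by simp_all
  have wf: "wf_ctx ?\<Delta>" by (rule wf_ctx_wk2[OF Bx By])
  note \<rho> = renaming_wk2[OF Bx By]
  have u: "?\<Delta> \<turnstile> Var 1 \<Colon> wk 2 (inst1 B x)" and v: "?\<Delta> \<turnstile> Var 0 \<Colon> wk 2 (inst1 B y)"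
    by (intro var_of_type[OF wf]; simp)+
  note ren_pair[OF \<rho> B x u] ren_pair[OF \<rho> B y v]
  moreover have "?\<Delta> \<turnstile> wk 2 (Sig A B) \<Colon> Univ i"
    using ren_has_type[OF sig_form[OF A B] \<rho>] by simp
  ultimately show ?thesis
    unfolding pairs_over_eq_def by (intro pi_form id_form Bx wk_type[OF Bx By])
qed

lemma pairs_over_eq_self:
  assumes A: "\<Gamma> \<turnstile> A \<Colon> Univ i" and B: "A # \<Gamma> \<turnstile> B \<Colon> Univ i" and x: "\<Gamma> \<turnstile> x \<Colon> A"
    and h: "\<Gamma> \<turnstile> h \<Colon> is_prop (inst1 B x)"
  shows "\<exists>t. \<Gamma> \<turnstile> t \<Colon> pairs_over_eq A B x x"
proof -
  let ?\<rho> = "\<lambda>n. n + 2" and ?\<Delta> = "wk 1 (inst1 B x) # inst1 B x # \<Gamma>"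
  let ?A = "ren ?\<rho> A" and ?B = "ren (up_ren ?\<rho>) B" and ?x = "ren ?\<rho> x"
  have Bx: "\<Gamma> \<turnstile> inst1 B x \<Colon> Univ i"
    using inst1_has_type[OF B x] by simp
  have wf: "wf_ctx ?\<Delta>" by (rule wf_ctx_wk2[OF Bx Bx])
  note \<rho> = renaming_wk2[OF Bx Bx]
  have A': "?\<Delta> \<turnstile> ?A \<Colon> Univ i" and B': "?A # ?\<Delta> \<turnstile> ?B \<Colon> Univ i" and x': "?\<Delta> \<turnstile> ?x \<Colon> ?A"
    using ren_has_type[OF A \<rho>] ren_up_has_type[OF B \<rho>] ren_has_type[OF x \<rho>] by simp_all
  have u: "?\<Delta> \<turnstile> Var 1 \<Colon> inst1 ?B ?x" and v: "?\<Delta> \<turnstile> Var 0 \<Colon> inst1 ?B ?x"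
    by (intro var_of_type[OF wf]; simp)+
  have "?\<Delta> \<turnstile> ren ?\<rho> h \<Colon> is_prop (inst1 ?B ?x)"
    using ren_has_type[OF h \<rho>] by simp
  from pair_eq_of_snd_eq[OF A' B' x' u v is_prop_elim[OF this u v]]
  show ?thesis
    unfolding pairs_over_eq_def by (auto intro!: pi_intro)
qed

lemma pair_eq_of_prop_family:
  assumes A: "\<Gamma> \<turnstile> A \<Colon> Univ i" and B: "A # \<Gamma> \<turnstile> B \<Colon> Univ i" and h: "\<Gamma> \<turnstile> h \<Colon> Pi A (is_prop B)"
    and x: "\<Gamma> \<turnstile> x \<Colon> A" and y: "\<Gamma> \<turnstile> y \<Colon> A" and p: "\<Gamma> \<turnstile> p \<Colon> IdT A x y"
    and u: "\<Gamma> \<turnstile> u \<Colon> inst1 B x" and v: "\<Gamma> \<turnstile> v \<Colon> inst1 B y"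
  shows "\<exists>q. \<Gamma> \<turnstile> q \<Colon> IdT (Sig A B) (Pr x u) (Pr y v)"
proof -
  let ?\<rho> = "\<lambda>n. n + 3" and ?\<rho>' = "\<lambda>n. n + 1"
  let ?C = "pairs_over_eq (ren ?\<rho> A) (ren (up_ren ?\<rho>) B) (Var 2) (Var 1)"
  note \<rho> = renaming_path_ctx[OF A]
  have C: "path_ctx A \<Gamma> \<turnstile> ?C \<Colon> Univ i"
    using ren_has_type[OF A \<rho>] ren_up_has_type[OF B \<rho>] path_ctx_vars[OF A]
    by (intro pairs_over_eq_form) simp_all
  have wf: "wf_ctx (A # \<Gamma>)" using B by (rule wf_ctx_of_has_type)
  note \<rho>' = renaming_Cons[OF wf]
  have "A # \<Gamma> \<turnstile> wk 1 h \<Colon> Pi (wk 1 A) (is_prop (ren (up_ren ?\<rho>') B))"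
    using ren_has_type[OF h \<rho>'] by simp
  then have "A # \<Gamma> \<turnstile> App (wk 1 h) (Var 0) \<Colon> is_prop (inst1 (ren (up_ren ?\<rho>') B) (Var 0))"
    by (rule pi_elim_of_type[OF _ var_0[OF wf]]) simp
  then have "\<exists>c. A # \<Gamma> \<turnstile> c \<Colon> pairs_over_eq (wk 1 A) (ren (up_ren ?\<rho>') B) (Var 0) (Var 0)"
    using ren_has_type[OF A \<rho>'] ren_up_has_type[OF B \<rho>']
    by (intro pairs_over_eq_self var_0[OF wf]) simp_all
  then obtain c where "A # \<Gamma> \<turnstile> c \<Colon> sub (Refl (Var 0) \<cdot> Var 0 \<cdot> Var 0 \<cdot> shift 1) ?C"
    by (auto simp: eval_nat_numeral)
  from id_elim[OF C this x y p] have "\<Gamma> \<turnstile> IdInd ?C c x y p \<Colon> pairs_over_eq A B x y"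
    by (simp add: eval_nat_numeral)
  then have "\<Gamma> \<turnstile> App (IdInd ?C c x y p) u \<Colon>
      Pi (inst1 B y) (IdT (wk 1 (Sig A B)) (Pr (wk 1 x) (wk 1 u)) (Pr (wk 1 y) (Var 0)))"
    unfolding pairs_over_eq_def
    by (rule pi_elim_of_type[OF _ u]) (simp add: eval_nat_numeral)
  then have "\<Gamma> \<turnstile> App (App (IdInd ?C c x y p) u) v \<Colon> IdT (Sig A B) (Pr x u) (Pr y v)"
    by (rule pi_elim_of_type[OF _ v]) simp
  then show ?thesis ..
qed

section \<open>First projection\<close>

definition proj1 :: "tm \<Rightarrow> tm \<Rightarrow> tm" where
  "proj1 A p = SigInd (wk 1 A) (Var 1) p"

lemma sub_proj1 [simp]: "sub \<sigma> (proj1 A p) = proj1 (sub \<sigma> A) (sub \<sigma> p)"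
  by (simp add: proj1_def eval_nat_numeral)

lemma ren_proj1 [simp]: "ren \<rho> (proj1 A p) = proj1 (ren \<rho> A) (ren \<rho> p)"
  by (simp add: proj1_def eval_nat_numeral)

context
  fixes \<Gamma> A B i
  assumes A: "\<Gamma> \<turnstile> A \<Colon> Univ i" and B: "A # \<Gamma> \<turnstile> B \<Colon> Univ i"
begin

lemma proj1_motive: "Sig A B # \<Gamma> \<turnstile> wk 1 A \<Colon> Univ i"
  by (rule wk_type[OF sig_form[OF A B] A])

lemma proj1_branch: "B # A # \<Gamma> \<turnstile> Var 1 \<Colon> sub (Pr (Var 1) (Var 0) \<cdot> shift 2) (wk 1 A)"
  by (rule var_of_type[OF wf_ctx_Cons[OF B]]) (simp_all add: eval_nat_numeral)

lemma proj1_has_type: "\<Gamma> \<turnstile> p \<Colon> Sig A B \<Longrightarrow> \<Gamma> \<turnstile> proj1 A p \<Colon> A"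
  unfolding proj1_def using sig_elim[OF proj1_motive proj1_branch] by fastforce

lemma proj1_Pr: "\<lbrakk>\<Gamma> \<turnstile> a \<Colon> A; \<Gamma> \<turnstile> b \<Colon> inst1 B a\<rbrakk> \<Longrightarrow> \<Gamma> \<turnstile> proj1 A (Pr a b) \<doteq> a \<Colon> A"
  unfolding proj1_def using sig_comp[OF proj1_motive proj1_branch] by fastforce

end

section \<open>Splittings\<close>

definition retraction_type :: "tm \<Rightarrow> tm \<Rightarrow> tm \<Rightarrow> tm" where
  "retraction_type A r s = Pi A (IdT (wk 1 A) (App (wk 1 r) (App (wk 1 s) (Var 0))) (Var 0))"

definition factorization_type :: "tm \<Rightarrow> tm \<Rightarrow> tm \<Rightarrow> tm \<Rightarrow> tm" where
  "factorization_type X f r s =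
     Pi X (IdT (wk 1 X) (App (wk 1 s) (App (wk 1 r) (Var 0))) (App (wk 1 f) (Var 0)))"

definition splitting_laws :: "tm \<Rightarrow> tm \<Rightarrow> tm \<Rightarrow> tm \<Rightarrow> tm \<Rightarrow> tm" where
  "splitting_laws X f A r s = Sig (retraction_type A r s) (wk 1 (factorization_type X f r s))"

definition splitting_sections :: "tm \<Rightarrow> tm \<Rightarrow> tm \<Rightarrow> tm \<Rightarrow> tm" where
  "splitting_sections X f A r =
     Sig (arrow A X) (splitting_laws (wk 1 X) (wk 1 f) (wk 1 A) (wk 1 r) (Var 0))"

definition splitting_through :: "tm \<Rightarrow> tm \<Rightarrow> tm \<Rightarrow> tm" where
  "splitting_through X f A =
     Sig (arrow X A) (splitting_sections (wk 1 X) (wk 1 f) (wk 1 A) (Var 0))"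

lemma splitting_eq: "splitting i X f = Sig (Univ i) (splitting_through (wk 1 X) (wk 1 f) (Var 0))"
  by (simp add: splitting_def splitting_through_def splitting_sections_def splitting_laws_def
      retraction_type_def factorization_type_def eval_nat_numeral)

lemma idempotence_eq: "idempotence X f = factorization_type X f f f"
  by (simp add: idempotence_def factorization_type_def)

lemma sub_splitting_laws [simp]: "sub \<sigma> (splitting_laws X f A r s) =
    splitting_laws (sub \<sigma> X) (sub \<sigma> f) (sub \<sigma> A) (sub \<sigma> r) (sub \<sigma> s)"
  by (simp add: splitting_laws_def retraction_type_def factorization_type_def)

lemma sub_splitting_sections [simp]: "sub \<sigma> (splitting_sections X f A r) =
    splitting_sections (sub \<sigma> X) (sub \<sigma> f) (sub \<sigma> A) (sub \<sigma> r)"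
  by (simp add: splitting_sections_def)

lemma sub_splitting_through [simp]: "sub \<sigma> (splitting_through X f A) =
    splitting_through (sub \<sigma> X) (sub \<sigma> f) (sub \<sigma> A)"
  by (simp add: splitting_through_def)

lemma retraction_family_form:
  assumes A: "\<Gamma> \<turnstile> A \<Colon> Univ i" and r: "\<Gamma> \<turnstile> r \<Colon> arrow X A" and s: "\<Gamma> \<turnstile> s \<Colon> arrow A X"
  shows "A # \<Gamma> \<turnstile> IdT (wk 1 A) (App (wk 1 r) (App (wk 1 s) (Var 0))) (Var 0) \<Colon> Univ i"
proof -
  have wf: "wf_ctx (A # \<Gamma>)" by (rule wf_ctx_Cons[OF A])
  show ?thesis
    by (intro id_form wk_type[OF A A] arrow_elim[OF wk_arrow[OF r wf]]
        arrow_elim[OF wk_arrow[OF s wf]] var_0[OF wf])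
qed

lemma factorization_type_form:
  assumes X: "\<Gamma> \<turnstile> X \<Colon> Univ i" and f: "\<Gamma> \<turnstile> f \<Colon> arrow X X"
    and r: "\<Gamma> \<turnstile> r \<Colon> arrow X A" and s: "\<Gamma> \<turnstile> s \<Colon> arrow A X"
  shows "\<Gamma> \<turnstile> factorization_type X f r s \<Colon> Univ i"
proof -
  have wf: "wf_ctx (X # \<Gamma>)" by (rule wf_ctx_Cons[OF X])
  show ?thesis
    unfolding factorization_type_def
    by (intro pi_form id_form X wk_type[OF X X] arrow_elim[OF wk_arrow[OF s wf]]
        arrow_elim[OF wk_arrow[OF r wf]] arrow_elim[OF wk_arrow[OF f wf]] var_0[OF wf])
qed

lemma
  assumes "\<Gamma> \<turnstile> X \<Colon> Univ i" "\<Gamma> \<turnstile> f \<Colon> arrow X X" "\<Gamma> \<turnstile> A \<Colon> Univ i"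
    and "\<Gamma> \<turnstile> r \<Colon> arrow X A" "\<Gamma> \<turnstile> s \<Colon> arrow A X"
  shows splitting_laws_family_form:
      "retraction_type A r s # \<Gamma> \<turnstile> wk 1 (factorization_type X f r s) \<Colon> Univ i"
    and splitting_laws_form: "\<Gamma> \<turnstile> splitting_laws X f A r s \<Colon> Univ i"
proof -
  have R: "\<Gamma> \<turnstile> retraction_type A r s \<Colon> Univ i"
    unfolding retraction_type_def
    by (rule pi_form[OF assms(3) retraction_family_form[OF assms(3-5)]])
  show F: "retraction_type A r s # \<Gamma> \<turnstile> wk 1 (factorization_type X f r s) \<Colon> Univ i"
    by (rule wk_type[OF R factorization_type_form[OF assms(1,2,4,5)]])
  show "\<Gamma> \<turnstile> splitting_laws X f A r s \<Colon> Univ i"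
    unfolding splitting_laws_def by (rule sig_form[OF R F])
qed

lemma
  assumes X: "\<Gamma> \<turnstile> X \<Colon> Univ i" and f: "\<Gamma> \<turnstile> f \<Colon> arrow X X"
    and A: "\<Gamma> \<turnstile> A \<Colon> Univ i" and r: "\<Gamma> \<turnstile> r \<Colon> arrow X A"
  shows splitting_sections_family_form:
      "arrow A X # \<Gamma> \<turnstile> splitting_laws (wk 1 X) (wk 1 f) (wk 1 A) (wk 1 r) (Var 0) \<Colon> Univ i"
    and splitting_sections_form: "\<Gamma> \<turnstile> splitting_sections X f A r \<Colon> Univ i"
proof -
  have AX: "\<Gamma> \<turnstile> arrow A X \<Colon> Univ i" by (rule arrow_form[OF A X])
  then have wf: "wf_ctx (arrow A X # \<Gamma>)" by (rule wf_ctx_Cons)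
  show L: "arrow A X # \<Gamma> \<turnstile> splitting_laws (wk 1 X) (wk 1 f) (wk 1 A) (wk 1 r) (Var 0) \<Colon> Univ i"
    using wk_has_type[OF f wf] wk_has_type[OF r wf] var_0[OF wf]
    by (intro splitting_laws_form wk_type[OF AX X] wk_type[OF AX A]) simp_all
  show "\<Gamma> \<turnstile> splitting_sections X f A r \<Colon> Univ i"
    unfolding splitting_sections_def by (rule sig_form[OF AX L])
qed

lemma
  assumes X: "\<Gamma> \<turnstile> X \<Colon> Univ i" and f: "\<Gamma> \<turnstile> f \<Colon> arrow X X" and A: "\<Gamma> \<turnstile> A \<Colon> Univ i"
  shows splitting_through_family_form:
      "arrow X A # \<Gamma> \<turnstile> splitting_sections (wk 1 X) (wk 1 f) (wk 1 A) (Var 0) \<Colon> Univ i"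
    and splitting_through_form: "\<Gamma> \<turnstile> splitting_through X f A \<Colon> Univ i"
proof -
  have XA: "\<Gamma> \<turnstile> arrow X A \<Colon> Univ i" by (rule arrow_form[OF X A])
  then have wf: "wf_ctx (arrow X A # \<Gamma>)" by (rule wf_ctx_Cons)
  show S: "arrow X A # \<Gamma> \<turnstile> splitting_sections (wk 1 X) (wk 1 f) (wk 1 A) (Var 0) \<Colon> Univ i"
    using wk_has_type[OF f wf] var_0[OF wf]
    by (intro splitting_sections_form wk_type[OF XA X] wk_type[OF XA A]) simp_all
  show "\<Gamma> \<turnstile> splitting_through X f A \<Colon> Univ i"
    unfolding splitting_through_def by (rule sig_form[OF XA S])
qed

lemma splitting_family_form:
  assumes X: "\<Gamma> \<turnstile> X \<Colon> Univ i" and f: "\<Gamma> \<turnstile> f \<Colon> arrow X X"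
  shows "Univ i # \<Gamma> \<turnstile> splitting_through (wk 1 X) (wk 1 f) (Var 0) \<Colon> Univ i"
proof -
  have U: "\<Gamma> \<turnstile> Univ i \<Colon> Univ (Suc i)" by (rule univ_intro[OF wf_ctx_of_has_type[OF X]])
  then have wf: "wf_ctx (Univ i # \<Gamma>)" by (rule wf_ctx_Cons)
  show ?thesis
    using wk_has_type[OF f wf] var_0[OF wf]
    by (intro splitting_through_form wk_type[OF U X]) simp_all
qed

lemma splitting_intro:
  assumes X: "\<Gamma> \<turnstile> X \<Colon> Univ i" and f: "\<Gamma> \<turnstile> f \<Colon> arrow X X"
    and A: "\<Gamma> \<turnstile> A \<Colon> Univ i" and r: "\<Gamma> \<turnstile> r \<Colon> arrow X A" and s: "\<Gamma> \<turnstile> s \<Colon> arrow A X"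
    and H: "\<Gamma> \<turnstile> H \<Colon> retraction_type A r s" and K: "\<Gamma> \<turnstile> K \<Colon> factorization_type X f r s"
  shows "\<Gamma> \<turnstile> Pr A (Pr r (Pr s (Pr H K))) \<Colon> splitting i X f"
proof -
  have "\<Gamma> \<turnstile> Pr H K \<Colon> splitting_laws X f A r s"
    unfolding splitting_laws_def using K
    by (intro sig_intro[OF splitting_laws_family_form[OF X f A r s] H]) simp
  then have "\<Gamma> \<turnstile> Pr s (Pr H K) \<Colon> splitting_sections X f A r"
    unfolding splitting_sections_def
    by (intro sig_intro[OF splitting_sections_family_form[OF X f A r] s]) simp
  then have "\<Gamma> \<turnstile> Pr r (Pr s (Pr H K)) \<Colon> splitting_through X f A"
    unfolding splitting_through_def
    by (intro sig_intro[OF splitting_through_family_form[OF X f A] r]) simp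
  then show ?thesis
    unfolding splitting_eq by (intro sig_intro[OF splitting_family_form[OF X f] A]) simp
qed

section \<open>The type of fixed points\<close>

definition fix_eq :: "tm \<Rightarrow> tm \<Rightarrow> tm" where
  "fix_eq X f = IdT (wk 1 X) (App (wk 1 f) (Var 0)) (Var 0)"

definition fix_type :: "tm \<Rightarrow> tm \<Rightarrow> tm" where
  "fix_type X f = Sig X (fix_eq X f)"

definition fix_retr :: "tm \<Rightarrow> tm \<Rightarrow> tm \<Rightarrow> tm" where
  "fix_retr X f I = Lam X (Pr (App (wk 1 f) (Var 0)) (App (wk 1 I) (Var 0)))"

definition fix_sect :: "tm \<Rightarrow> tm \<Rightarrow> tm" where
  "fix_sect X f = Lam (fix_type X f) (proj1 (wk 1 X) (Var 0))"

lemma sub_scons_fix_eq [simp]: "sub (a \<cdot> \<sigma>) (fix_eq X f) = IdT (sub \<sigma> X) (App (sub \<sigma> f) a) a"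
  by (simp add: fix_eq_def)

lemma ren_fix_type [simp]: "ren \<rho> (fix_type X f) = fix_type (ren \<rho> X) (ren \<rho> f)"
  by (simp add: fix_type_def fix_eq_def)

lemma sub_fix_type [simp]: "sub \<sigma> (fix_type X f) = fix_type (sub \<sigma> X) (sub \<sigma> f)"
  by (simp add: fix_type_def fix_eq_def)

lemma ren_fix_retr [simp]: "ren \<rho> (fix_retr X f I) = fix_retr (ren \<rho> X) (ren \<rho> f) (ren \<rho> I)"
  by (simp add: fix_retr_def)

lemma sub_fix_retr [simp]: "sub \<sigma> (fix_retr X f I) = fix_retr (sub \<sigma> X) (sub \<sigma> f) (sub \<sigma> I)"
  by (simp add: fix_retr_def)

lemma ren_fix_sect [simp]: "ren \<rho> (fix_sect X f) = fix_sect (ren \<rho> X) (ren \<rho> f)"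
  by (simp add: fix_sect_def)

lemma sub_fix_sect [simp]: "sub \<sigma> (fix_sect X f) = fix_sect (sub \<sigma> X) (sub \<sigma> f)"
  by (simp add: fix_sect_def)

lemma ren_idempotence [simp]: "ren \<rho> (idempotence X f) = idempotence (ren \<rho> X) (ren \<rho> f)"
  by (simp add: idempotence_def)

lemma fix_eq_form:
  assumes X: "\<Gamma> \<turnstile> X \<Colon> Univ i" and f: "\<Gamma> \<turnstile> f \<Colon> arrow X X"
  shows "X # \<Gamma> \<turnstile> fix_eq X f \<Colon> Univ i"
proof -
  have wf: "wf_ctx (X # \<Gamma>)" by (rule wf_ctx_Cons[OF X])
  show ?thesis
    unfolding fix_eq_def
    by (intro id_form wk_type[OF X X] arrow_elim[OF wk_arrow[OF f wf]] var_0[OF wf])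
qed

lemma fix_type_form:
  assumes X: "\<Gamma> \<turnstile> X \<Colon> Univ i" and f: "\<Gamma> \<turnstile> f \<Colon> arrow X X"
  shows "\<Gamma> \<turnstile> fix_type X f \<Colon> Univ i"
  unfolding fix_type_def by (rule sig_form[OF X fix_eq_form[OF X f]])

lemma fix_type_intro:
  assumes X: "\<Gamma> \<turnstile> X \<Colon> Univ i" and f: "\<Gamma> \<turnstile> f \<Colon> arrow X X"
    and a: "\<Gamma> \<turnstile> a \<Colon> X" and p: "\<Gamma> \<turnstile> p \<Colon> IdT X (App f a) a"
  shows "\<Gamma> \<turnstile> Pr a p \<Colon> fix_type X f"
  unfolding fix_type_def using p by (intro sig_intro[OF fix_eq_form[OF X f] a]) simp

lemma idempotence_elim:
  assumes "\<Gamma> \<turnstile> I \<Colon> idempotence X f" "\<Gamma> \<turnstile> a \<Colon> X"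
  shows "\<Gamma> \<turnstile> App I a \<Colon> IdT X (App f (App f a)) (App f a)"
  using assms(1) unfolding idempotence_def
  by (rule pi_elim_of_type[OF _ assms(2)]) simp

section \<open>Splitting an idempotent through its fixed points\<close>

locale idempotent_map =
  fixes \<Gamma> i X f I
  assumes X: "\<Gamma> \<turnstile> X \<Colon> Univ i" and f: "\<Gamma> \<turnstile> f \<Colon> arrow X X" and I: "\<Gamma> \<turnstile> I \<Colon> idempotence X f"
begin

lemma renamed: "renaming \<Delta> \<rho> \<Gamma> \<Longrightarrow> idempotent_map \<Delta> i (ren \<rho> X) (ren \<rho> f) (ren \<rho> I)"
  using ren_has_type[OF X] ren_has_type[OF f] ren_has_type[OF I] by unfold_locales auto

lemma image_pair: "\<Gamma> \<turnstile> a \<Colon> X \<Longrightarrow> \<Gamma> \<turnstile> Pr (App f a) (App I a) \<Colon> fix_type X f"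
  by (intro fix_type_intro[OF X f] arrow_elim[OF f] idempotence_elim[OF I])

lemma ctx_X: "wf_ctx (X # \<Gamma>)"
  by (rule wf_ctx_Cons[OF X])

lemma fix_retr_body:
  "X # \<Gamma> \<turnstile> Pr (App (wk 1 f) (Var 0)) (App (wk 1 I) (Var 0)) \<Colon> wk 1 (fix_type X f)"
proof -
  interpret ext: idempotent_map "X # \<Gamma>" i "wk 1 X" "wk 1 f" "wk 1 I"
    by (rule renamed[OF renaming_Cons[OF ctx_X]])
  show ?thesis using ext.image_pair[OF var_0[OF ctx_X]] by simp
qed

lemma fix_retr_type: "\<Gamma> \<turnstile> fix_retr X f I \<Colon> arrow X (fix_type X f)"
  unfolding fix_retr_def by (rule arrow_intro[OF fix_retr_body])

lemma fix_retr_app: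
  assumes "\<Gamma> \<turnstile> a \<Colon> X"
  shows "\<Gamma> \<turnstile> App (fix_retr X f I) a \<doteq> Pr (App f a) (App I a) \<Colon> fix_type X f"
  unfolding fix_retr_def using pi_comp[OF fix_retr_body assms] by simp

lemma fix_sect_body: "fix_type X f # \<Gamma> \<turnstile> proj1 (wk 1 X) (Var 0) \<Colon> wk 1 X"
proof -
  have wf: "wf_ctx (fix_type X f # \<Gamma>)"
    by (rule wf_ctx_Cons[OF fix_type_form[OF X f]])
  interpret ext: idempotent_map "fix_type X f # \<Gamma>" i "wk 1 X" "wk 1 f" "wk 1 I"
    by (rule renamed[OF renaming_Cons[OF wf]])
  show ?thesis
    using var_0[OF wf] by (intro proj1_has_type[OF ext.X fix_eq_form[OF ext.X ext.f]])
      (simp add: fix_type_def fix_eq_def)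
qed

lemma fix_sect_type: "\<Gamma> \<turnstile> fix_sect X f \<Colon> arrow (fix_type X f) X"
  unfolding fix_sect_def by (rule arrow_intro[OF fix_sect_body])

lemma fix_sect_Pr:
  assumes a: "\<Gamma> \<turnstile> a \<Colon> X" and p: "\<Gamma> \<turnstile> p \<Colon> IdT X (App f a) a"
  shows "\<Gamma> \<turnstile> App (fix_sect X f) (Pr a p) \<doteq> a \<Colon> X"
proof (rule eq_trans)
  show "\<Gamma> \<turnstile> App (fix_sect X f) (Pr a p) \<doteq> proj1 X (Pr a p) \<Colon> X"
    using pi_comp[OF fix_sect_body fix_type_intro[OF X f a p]] by (simp add: fix_sect_def)
  show "\<Gamma> \<turnstile> proj1 X (Pr a p) \<doteq> a \<Colon> X"
    using p by (intro proj1_Pr[OF X fix_eq_form[OF X f] a]) simp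
qed

lemma fix_sect_retr_app:
  assumes a: "\<Gamma> \<turnstile> a \<Colon> X"
  shows "\<Gamma> \<turnstile> App (fix_sect X f) (App (fix_retr X f I) a) \<doteq> App f a \<Colon> X"
  by (rule eq_trans[OF arrow_elim_eq[OF fix_sect_type fix_retr_app[OF a]]
        fix_sect_Pr[OF arrow_elim[OF f a] idempotence_elim[OF I a]]])

lemma fix_retr_sect_Pr:
  assumes a: "\<Gamma> \<turnstile> a \<Colon> X" and p: "\<Gamma> \<turnstile> p \<Colon> IdT X (App f a) a"
  shows "\<Gamma> \<turnstile> App (fix_retr X f I) (App (fix_sect X f) (Pr a p)) \<doteq>
    Pr (App f a) (App I a) \<Colon> fix_type X f"
  by (rule eq_trans[OF arrow_elim_eq[OF fix_retr_type fix_sect_Pr[OF a p]] fix_retr_app[OF a]])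

lemma fix_factorization: "\<exists>K. \<Gamma> \<turnstile> K \<Colon> factorization_type X f (fix_retr X f I) (fix_sect X f)"
proof -
  interpret ext: idempotent_map "X # \<Gamma>" i "wk 1 X" "wk 1 f" "wk 1 I"
    by (rule renamed[OF renaming_Cons[OF ctx_X]])
  note x = var_0[OF ctx_X]
  have fx: "X # \<Gamma> \<turnstile> App (wk 1 f) (Var 0) \<Colon> wk 1 X" by (rule arrow_elim[OF ext.f x])
  have "X # \<Gamma> \<turnstile> Refl (App (wk 1 f) (Var 0)) \<Colon> IdT (wk 1 X)
      (App (fix_sect (wk 1 X) (wk 1 f)) (App (fix_retr (wk 1 X) (wk 1 f) (wk 1 I)) (Var 0)))
      (App (wk 1 f) (Var 0))"
    by (rule conv[OF id_intro[OF ext.X fx]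
          id_form_eq[OF eq_refl[OF ext.X] eq_sym[OF ext.fix_sect_retr_app[OF x]] eq_refl[OF fx]]])
  from pi_intro[OF this] show ?thesis by (auto simp: factorization_type_def)
qed

end

locale set_idempotent = idempotent_map +
  fixes uip
  assumes uip: "\<Gamma> \<turnstile> uip \<Colon> is_set X"
begin

lemma set_renamed:
  "renaming \<Delta> \<rho> \<Gamma> \<Longrightarrow> set_idempotent \<Delta> i (ren \<rho> X) (ren \<rho> f) (ren \<rho> I) (ren \<rho> uip)"
  using renamed[of \<Delta> \<rho>] ren_has_type[OF uip]
  by (auto simp: set_idempotent_def set_idempotent_axioms_def)

lemma fix_eq_prop: "\<exists>h. \<Gamma> \<turnstile> h \<Colon> Pi X (is_prop (fix_eq X f))"
proof -
  interpret ext: set_idempotent "X # \<Gamma>" i "wk 1 X" "wk 1 f" "wk 1 I" "wk 1 uip"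
    by (rule set_renamed[OF renaming_Cons[OF ctx_X]])
  note x = var_0[OF ctx_X]
  show ?thesis
    unfolding fix_eq_def
    using pi_intro[OF is_set_elim[OF ext.uip arrow_elim[OF ext.f x] x]] by blast
qed

lemma fix_retr_sect_Pr_path:
  assumes a: "\<Gamma> \<turnstile> a \<Colon> X" and p: "\<Gamma> \<turnstile> p \<Colon> IdT X (App f a) a"
  shows "\<exists>q. \<Gamma> \<turnstile> q \<Colon>
    IdT (fix_type X f) (App (fix_retr X f I) (App (fix_sect X f) (Pr a p))) (Pr a p)"
proof -
  obtain h where h: "\<Gamma> \<turnstile> h \<Colon> Pi X (is_prop (fix_eq X f))"
    using fix_eq_prop by blast
  obtain q where "\<Gamma> \<turnstile> q \<Colon> IdT (fix_type X f) (Pr (App f a) (App I a)) (Pr a p)"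
    using pair_eq_of_prop_family[OF X fix_eq_form[OF X f] h arrow_elim[OF f a] a p]
      idempotence_elim[OF I a] p
    by (fastforce simp: fix_type_def)
  then show ?thesis
    using id_form_eq[OF eq_refl[OF fix_type_form[OF X f]] eq_sym[OF fix_retr_sect_Pr[OF a p]]
        eq_refl[OF fix_type_intro[OF X f a p]]]
    by (blast intro: conv)
qed

lemma fix_retraction: "\<exists>H. \<Gamma> \<turnstile> H \<Colon> retraction_type (fix_type X f) (fix_retr X f I) (fix_sect X f)"
proof -
  let ?C = "IdT (wk 1 (fix_type X f))
      (App (wk 1 (fix_retr X f I)) (App (wk 1 (fix_sect X f)) (Var 0))) (Var 0)"
  let ?\<Delta> = "fix_eq X f # X # \<Gamma>"
  have C: "Sig X (fix_eq X f) # \<Gamma> \<turnstile> ?C \<Colon> Univ i"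
    using retraction_family_form[OF fix_type_form[OF X f] fix_retr_type fix_sect_type]
    by (simp only: fix_type_def)
  have wf: "wf_ctx ?\<Delta>" by (rule wf_ctx_Cons[OF fix_eq_form[OF X f]])
  have "renaming ?\<Delta> (\<lambda>n. n + 2) \<Gamma>"
    using renaming_wk[of "[fix_eq X f, X]"] wf by (simp add: eval_nat_numeral)
  then interpret \<Delta>: set_idempotent ?\<Delta> i "wk 2 X" "wk 2 f" "wk 2 I" "wk 2 uip"
    by (rule set_renamed)
  have x: "?\<Delta> \<turnstile> Var 1 \<Colon> wk 2 X"
    and p: "?\<Delta> \<turnstile> Var 0 \<Colon> IdT (wk 2 X) (App (wk 2 f) (Var 1)) (Var 1)"
    by (intro var_of_type[OF wf]; simp add: fix_eq_def eval_nat_numeral)+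
  obtain q where "?\<Delta> \<turnstile> q \<Colon> sub (Pr (Var 1) (Var 0) \<cdot> shift 2) ?C"
    using \<Delta>.fix_retr_sect_Pr_path[OF x p] by auto
  from pi_sig_intro[OF C this] show ?thesis by (simp add: retraction_type_def fix_type_def)
qed

lemma idempotent_splits: "\<exists>t. \<Gamma> \<turnstile> t \<Colon> splitting i X f"
  using fix_retraction fix_factorization
    splitting_intro[OF X f fix_type_form[OF X f] fix_retr_type fix_sect_type] by blast

end

lemma wf_idempotent_ctx:
  "wf_ctx [idempotence (Var 2) (Var 0), arrow (Var 1) (Var 1), is_set (Var 0), Univ i]"
proof -
  have w0: "wf_ctx [Univ i]"
    by (rule ctx_ext[OF ctx_empty univ_intro[OF ctx_empty]])
  have "[Univ i] \<turnstile> Var 0 \<Colon> Univ i"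
    by (rule var_of_type[OF w0]) simp_all
  then have w1: "wf_ctx [is_set (Var 0), Univ i]"
    by (intro wf_ctx_Cons is_set_form)
  have "[is_set (Var 0), Univ i] \<turnstile> Var 1 \<Colon> Univ i"
    by (rule var_of_type[OF w1]) simp_all
  then have w2: "wf_ctx [arrow (Var 1) (Var 1), is_set (Var 0), Univ i]"
    by (intro wf_ctx_Cons arrow_form)
  let ?\<Gamma> = "[arrow (Var 1) (Var 1), is_set (Var 0), Univ i]"
  have X: "?\<Gamma> \<turnstile> Var 2 \<Colon> Univ i" and f: "?\<Gamma> \<turnstile> Var 0 \<Colon> arrow (Var 2) (Var 2)"
    by (rule var_of_type[OF w2]; simp add: eval_nat_numeral)+
  show ?thesis
    unfolding idempotence_eq by (rule wf_ctx_Cons[OF factorization_type_form[OF X f f f]])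
qed

theorem theorem3p7:
  fixes i :: nat
  shows "\<exists>t. [] \<turnstile> t \<Colon>
    Pi (Univ i)
     (Pi (is_set (Var 0))
       (Pi (arrow (Var 1) (Var 1))
         (Pi (idempotence (Var 2) (Var 0))
           (splitting i (Var 3) (Var 1)))))"
proof -
  let ?\<Gamma> = "[idempotence (Var 2) (Var 0), arrow (Var 1) (Var 1), is_set (Var 0), Univ i]"
  interpret set_idempotent ?\<Gamma> i "Var 3" "Var 1" "Var 0" "Var 2"
    by unfold_locales (rule var_of_type[OF wf_idempotent_ctx]; simp add: eval_nat_numeral)+
  obtain t where "?\<Gamma> \<turnstile> t \<Colon> splitting i (Var 3) (Var 1)"
    using idempotent_splits by blast
  then show ?thesis
    by (blast intro: pi_intro)
qed

end
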